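(* For all $n\ge1$, $$g(n)=c(n)\,(3n+1)\,K(n)+T(n).$$ Consequently $g$ lies in the $2$-dimensional $\mathbb{Q}(n)$-module spanned by the hypergeometric terms $(3n+1)K(n)$ and $T(n)$, and therefore satisfies a second-order linear recurrence with polynomial coefficients. Explicitly, for all $m\ge 3$, $$p_0(m)\,g(m)+p_1(m)\,g(m-1)+p_2(m)\,g(m-2)=0,$$ where $p_0,p_1,p_2$ are the following polynomials of degree $12$: \begin{align*} p_0(m) &= 258048 m^{12} + 1169664 m^{11} + 326816 m^{10} - 5324160 m^{9} - 6298026 m^{8} + 6420627 m^{7} + 12567093 m^{6}\\ &\quad - 643740 m^{5} - 8475047 m^{4} - 2174541 m^{3} + 1536066 m^{2} + 353700 m - 113400,\\ p_1(m) &= -13934592 m^{12} - 28325376 m^{11} + 80053056 m^{10} + 126497520 m^{9} - 162057066 m^{8} - 177863088 m^{7} + 133677768 m^{6}\\ &\quad + 95456580 m^{5} - 43376892 m^{4} - 16667436 m^{3} + 5184126 m^{2} + 334800 m - 113400,\\ p_2(m) &= 188116992 m^{12} - 87899904 m^{11} - 1694242656 m^{10} + 1930644720 m^{9} + 3397410216 m^{8} - 5838018732 m^{7} - 342563508 m^{6}\\ &\quad + 4226543280 m^{5} - 1437148908 m^{4} - 737373564 m^{3} + 448283664 m^{2} - 62823600 m + 6350400. \end{align*}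
   Context: A solid standard Young tableau of a three-dimensional shape with $N$ cells is a bijective filling of the cells by $1,\dots,N$ that is increasing in each of the three coordinate directions. For $n\ge1$ let $S_n=[[n,n],[n,1]]$ be the two-layer shape with rows $(1,1),(1,2),(2,1)$ of length $n$ and row $(2,2)$ of length $1$; that is, $S_n=\{(i,j,k): (i,j)\in\{(1,1),(1,2),(2,1)\},\ 1\le k\le n\}\cup\{(2,2,1)\}$, with $3n+1$ cells. Let $g(n)$ be the number of solid standard Young tableaux of shape $S_n$. Further $$K(n)=\frac{4^{n}(3n)!}{(n+1)!\,(2n+1)!},\qquad c(n)=\frac{8n^{2}+n-24}{4(n+2)(2n+3)},\qquad T(n)=\frac{7n+5}{5}\prod_{k=1}^{n}\frac{6(2k-1)(6k-1)(6k+1)}{(k+1)(4k+3)(4k+5)}.$$ A hypergeometric term is a sequence whose consecutive ratio is a rational function of $n$. *)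

theory Defs
  imports
    "HOL-Computational_Algebra.Computational_Algebra"
    "HOL-Computational_Algebra.Field_as_Ring"
    "HOL-Library.FuncSet"
begin

definition solid_SYT :: "(nat \<times> nat \<times> nat) set \<Rightarrow> (nat \<times> nat \<times> nat \<Rightarrow> nat) set" where
  "solid_SYT S = {t \<in> extensional S. bij_betw t S {1..card S} \<and>
     (\<forall>i i' j k. (i, j, k) \<in> S \<longrightarrow> (i', j, k) \<in> S \<longrightarrow> i < i' \<longrightarrow> t (i, j, k) < t (i', j, k)) \<and>
     (\<forall>i j j' k. (i, j, k) \<in> S \<longrightarrow> (i, j', k) \<in> S \<longrightarrow> j < j' \<longrightarrow> t (i, j, k) < t (i, j', k)) \<and>
     (\<forall>i j k k'. (i, j, k) \<in> S \<longrightarrow> (i, j, k') \<in> S \<longrightarrow> k < k' \<longrightarrow> t (i, j, k) < t (i, j, k'))}"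

definition S_shape :: "nat \<Rightarrow> (nat \<times> nat \<times> nat) set" where
  "S_shape n = {(i, j, k). (i, j) \<in> {(1, 1), (1, 2), (2, 1)} \<and> 1 \<le> k \<and> k \<le> n} \<union> {(2, 2, 1)}"

definition g_num :: "nat \<Rightarrow> nat" where
  "g_num n = card (solid_SYT (S_shape n))"

definition K_term :: "nat \<Rightarrow> rat" where
  "K_term n = 4 ^ n * fact (3 * n) / (fact (n + 1) * fact (2 * n + 1))"

definition c_coeff :: "nat \<Rightarrow> rat" where
  "c_coeff n = (8 * of_nat n ^ 2 + of_nat n - 24) / (4 * (of_nat n + 2) * (2 * of_nat n + 3))"

definition T_term :: "nat \<Rightarrow> rat" where
  "T_term n = (7 * of_nat n + 5) / 5 *
     (\<Prod>k = 1..n. 6 * (2 * of_nat k - 1) * (6 * of_nat k - 1) * (6 * of_nat k + 1) /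
        ((of_nat k + 1) * (4 * of_nat k + 3) * (4 * of_nat k + 5)))"

text \<open>
  The field \<open>\<rat>(n)\<close> is the type \<open>rat poly fract\<close>. A rational function is evaluated through its
  representation in lowest terms; at a pole the value is \<open>0\<close> by the convention \<open>x / 0 = 0\<close>.
\<close>

definition ratfun_eval :: "rat poly fract \<Rightarrow> nat \<Rightarrow> rat" where
  "ratfun_eval r n =
     poly (fst (quot_of_fract r)) (of_nat n) / poly (snd (quot_of_fract r)) (of_nat n)"

text \<open>Since the terms are required not to vanish, the ratio below is never taken at a pole of \<open>r\<close>.\<close>

definition hypergeometric_term :: "(nat \<Rightarrow> rat) \<Rightarrow> bool" where
  "hypergeometric_term f \<longleftrightarrow>
     (\<exists>r. \<forall>n\<ge>1. f n \<noteq> 0 \<and> f (n + 1) / f n = ratfun_eval r n)"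

text \<open>
  A rational function may have poles at finitely many natural numbers, so \<open>\<rat>(n)\<close> acts on
  sequences only up to finitely many terms: the \<open>\<rat>(n)\<close>-module in question consists of the
  sequences modulo eventual equality.
\<close>

quotient_type germ = "nat \<Rightarrow> rat" / "\<lambda>f h. eventually (\<lambda>n. f n = h n) sequentially"
proof (rule equivpI)
  show "reflp (\<lambda>f h. eventually (\<lambda>n. f n = (h n :: rat)) sequentially)"
    by (rule reflpI) simp
  show "symp (\<lambda>f h. eventually (\<lambda>n. f n = (h n :: rat)) sequentially)"
    by (rule sympI) (simp add: eq_commute)
  show "transp (\<lambda>f h. eventually (\<lambda>n. f n = (h n :: rat)) sequentially)"
    by (rule transpI) (auto elim: eventually_elim2)
qed

lift_definition germ_of :: "(nat \<Rightarrow> rat) \<Rightarrow> germ" is "\<lambda>f. f" .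

instantiation germ :: ab_group_add
begin

lift_definition zero_germ :: germ is "\<lambda>n. 0" .

lift_definition plus_germ :: "germ \<Rightarrow> germ \<Rightarrow> germ" is "\<lambda>f h n. f n + h n"
  by (auto elim: eventually_elim2)

lift_definition minus_germ :: "germ \<Rightarrow> germ \<Rightarrow> germ" is "\<lambda>f h n. f n - h n"
  by (auto elim: eventually_elim2)

lift_definition uminus_germ :: "germ \<Rightarrow> germ" is "\<lambda>f n. - f n"
  by (auto elim: eventually_mono)

instance
  by standard (transfer; simp add: algebra_simps)+

end

lift_definition germ_scale :: "rat poly fract \<Rightarrow> germ \<Rightarrow> germ" is "\<lambda>r f n. ratfun_eval r n * f n"
  by (auto elim: eventually_mono)

lemma eventually_poly_nonzero:
  fixes q :: "rat poly"
  assumes "q \<noteq> 0"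
  shows "eventually (\<lambda>n. poly q (of_nat n) \<noteq> 0) sequentially"
proof -
  have "finite {x. poly q x = 0}"
    using assms by (rule poly_roots_finite)
  then have "finite ((of_nat :: nat \<Rightarrow> rat) -` {x. poly q x = 0})"
    by (rule finite_vimageI) (simp add: inj_on_def)
  then show ?thesis
    by (simp add: cofinite_eq_sequentially [symmetric] eventually_cofinite vimage_def)
qed

lemma eventually_ratfun_eval_Fract:
  assumes "q \<noteq> 0"
  shows "eventually (\<lambda>n. ratfun_eval (Fract p q) n = poly p (of_nat n) / poly q (of_nat n)) sequentially"
proof -
  define a b where "a = fst (quot_of_fract (Fract p q))" and "b = snd (quot_of_fract (Fract p q))"
  have b: "b \<noteq> 0"
    by (simp add: b_def)
  have "Fract a b = Fract p q"
    unfolding a_def b_def by (rule Fract_quot_of_fract)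
  then have "a * q = p * b"
    using b assms by (simp add: eq_fract)
  then have *: "poly a x * poly q x = poly p x * poly b x" for x
    by (metis poly_mult)
  show ?thesis
    using eventually_poly_nonzero [OF b] eventually_poly_nonzero [OF assms]
    by eventually_elim (use * in \<open>simp add: ratfun_eval_def a_def b_def frac_eq_eq\<close>)
qed

lemma eventually_ratfun_eval_add:
  "eventually (\<lambda>n. ratfun_eval (r + s) n = ratfun_eval r n + ratfun_eval s n) sequentially"
proof -
  obtain p q where r: "r = Fract p q" "q \<noteq> 0" by (cases r) auto
  obtain u v where s: "s = Fract u v" "v \<noteq> 0" by (cases s) auto
  have rs: "r + s = Fract (p * v + u * q) (q * v)" and qv: "q * v \<noteq> 0"
    using r s by simp_all
  show ?thesis
    using eventually_ratfun_eval_Fract [OF r(2), of p] eventually_ratfun_eval_Fract [OF s(2), of u]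
      eventually_ratfun_eval_Fract [OF qv, of "p * v + u * q"]
      eventually_poly_nonzero [OF r(2)] eventually_poly_nonzero [OF s(2)]
    unfolding rs unfolding r(1) s(1) by eventually_elim (simp add: add_frac_eq)
qed

lemma eventually_ratfun_eval_mult:
  "eventually (\<lambda>n. ratfun_eval (r * s) n = ratfun_eval r n * ratfun_eval s n) sequentially"
proof -
  obtain p q where r: "r = Fract p q" "q \<noteq> 0" by (cases r) auto
  obtain u v where s: "s = Fract u v" "v \<noteq> 0" by (cases s) auto
  have rs: "r * s = Fract (p * u) (q * v)" and qv: "q * v \<noteq> 0"
    using r s by simp_all
  show ?thesis
    using eventually_ratfun_eval_Fract [OF r(2), of p] eventually_ratfun_eval_Fract [OF s(2), of u]
      eventually_ratfun_eval_Fract [OF qv, of "p * u"]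
    unfolding rs unfolding r(1) s(1) by eventually_elim simp
qed

lemma ratfun_eval_1: "ratfun_eval 1 n = 1"
  by (simp add: ratfun_eval_def)

interpretation germ: vector_space germ_scale
proof
  show "germ_scale a (x + y) = germ_scale a x + germ_scale a y" for a x y
    by transfer (simp add: algebra_simps)
  show "germ_scale (a + b) x = germ_scale a x + germ_scale b x" for a b x
  proof (induction x rule: germ.abs_induct)
    case (1 x)
    show ?case
      unfolding germ_scale.abs_eq plus_germ.abs_eq germ.abs_eq_iff
      using eventually_ratfun_eval_add [of a b] by eventually_elim (simp add: algebra_simps)
  qed
  show "germ_scale a (germ_scale b x) = germ_scale (a * b) x" for a b x
  proof (induction x rule: germ.abs_induct)
    case (1 x)
    show ?case
      unfolding germ_scale.abs_eq germ.abs_eq_iff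
      using eventually_ratfun_eval_mult [of a b] by eventually_elim simp
  qed
  show "germ_scale 1 x = x" for x
    by (induction x rule: germ.abs_induct) (simp add: germ_scale.abs_eq ratfun_eval_1)
qed

definition p0_poly :: "rat poly" where
  "p0_poly =
    [:-113400, 353700, 1536066, -2174541, -8475047,
      -643740, 12567093, 6420627, -6298026, -5324160,
      326816, 1169664, 258048:]"

definition p1_poly :: "rat poly" where
  "p1_poly =
    [:-113400, 334800, 5184126, -16667436, -43376892,
      95456580, 133677768, -177863088, -162057066, 126497520,
      80053056, -28325376, -13934592:]"

definition p2_poly :: "rat poly" where
  "p2_poly =
    [:6350400, -62823600, 448283664, -737373564, -1437148908,
      4226543280, -342563508, -5838018732, 3397410216, 1930644720,
      -1694242656, -87899904, 188116992:]"

end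

theory Submission
  imports Defs
begin

text \<open>
  Reading a tableau of shape \<open>S\<^sub>n\<close> in the order of its entries gives a word: write \<open>A\<close>, \<open>B\<close>, \<open>C\<close>,
  \<open>D\<close> for a cell of the row \<open>(1,1)\<close>, \<open>(1,2)\<close>, \<open>(2,1)\<close>, \<open>(2,2)\<close>. The letters other than \<open>D\<close> form
  a word in which every prefix contains at least as many \<open>A\<close> as \<open>B\<close> and at least as many \<open>A\<close> as \<open>C\<close>
  (a Kreweras word), and \<open>D\<close> stands after the first \<open>B\<close> and the first \<open>C\<close>. A Kreweras word of length
  \<open>3n\<close> has \<open>3n + 1\<close> slots for \<open>D\<close>; the forbidden ones are those preceded by a prefix in which \<open>B\<close> or
  \<open>C\<close> is missing. Hence \<open>g(n) = (3n+1) K(n) - e(n)\<close>, where \<open>e(n)\<close> counts the pairs of a Kreweras word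
  and such a prefix. Removing the largest entry of a tableau turns these counts into recurrences
  (\<open>syt_rec\<close>, \<open>early_count_rec\<close>).

  A word with \<open>a\<close>, \<open>b\<close>, \<open>c\<close> letters of the three kinds is given the weight
  \<open>x\<^sup>a\<^sup>-\<^sup>b y\<^sup>a\<^sup>-\<^sup>c t\<^sup>a\<^sup>+\<^sup>b\<^sup>+\<^sup>c\<close>. If the walks start with weights \<open>I\<close>, the generating function \<open>K\<close>
  satisfies
  \<open>(xy - t(x + y + x\<^sup>2y\<^sup>2)) K = xy I - tx F(x) - ty F(y)\<close> with \<open>F(x) = K(x,0)\<close>, and for \<open>e(n)\<close> the
  weight \<open>I\<close> enumerates the prefixes: those with \<open>C\<close> missing, plus those with \<open>B\<close> missing, minus those
  made of \<open>A\<close> only. The equation determines \<open>K\<close> in the ring of power series, so a pair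
  \<open>(K, F)\<close> of power series that solves it is the generating function (\<open>boundary_eq_coeff\<close>), and no
  substitution of roots of the kernel is needed.

  The solutions are explicit. Let \<open>b = 1 + 4t\<^sup>3b\<^sup>3\<close>, \<open>\<rho>\<^sup>2 = b\<close>, \<open>w = 2b\<close>, \<open>W = tw\<close>, so that
  \<open>w = 2 + W\<^sup>3\<close>, and let \<open>p = \<surd>(1 - xW\<^sup>2)\<close>, \<open>q = \<surd>(1 - yW\<^sup>2)\<close>. The kernel divides, up to units and
  powers of the variables, the sum of \<open>(1/W - 1/x) p\<close> and \<open>(1/W - 1/y) q\<close> (\<open>kernel_factor_id\<close>).
  Moreover \<open>x + 1/(tx) - 1/x\<^sup>2\<close> takes the same value at \<open>x\<close> and at \<open>y\<close> modulo the kernel. Up to an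
  explicit elementary summand, \<open>tx F(x)\<close> is therefore \<open>(1/W - 1/x) p\<close> times a rational function of
  this invariant, which is fixed by the requirement that \<open>F\<close> have no pole at \<open>x = 0\<close> and, for the words in
  \<open>A\<close> only, at \<open>x = t\<close>. The three sources are treated in \<open>kreweras_solution\<close>,
  \<open>ballot_sources_solution\<close> and \<open>diagonal_source_solution\<close>. At \<open>x = 0\<close> one finds
  polynomials in \<open>b\<close> for the first two and \<open>1 - (2\<rho> + \<rho>\<^sup>-\<^sup>1 + \<rho>\<^sup>-\<^sup>3)/4\<close>, divided by \<open>t\<^sup>3\<close>, for the
  third. The coefficients of all powers of \<open>b\<close> are known (\<open>ternary_pow_nth\<close>): integral exponents give
  multiples of \<open>K(n)\<close> by rational functions of \<open>n\<close>, half-integral ones give \<open>T(n)\<close>.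

  The two hypergeometric terms are linearly independent over \<open>\<rat>(n)\<close> because the ratio of their
  ratios has, in the residue class of \<open>-7/4\<close> modulo \<open>\<int>\<close>, exactly one pole or zero, whereas the
  orders of \<open>R(n+1)/R(n)\<close> in any such class add up to \<open>0\<close> for a rational function \<open>R\<close>. The recurrence is a
  pair of polynomial identities, one for each term.
\<close>

section \<open>Counting tableaux by removing the largest entry\<close>

text \<open>\<open>s\<close> precedes \<open>s'\<close> in one of the three coordinate directions.\<close>
definition cell_less :: "nat \<times> nat \<times> nat \<Rightarrow> nat \<times> nat \<times> nat \<Rightarrow> bool" where
  "cell_less s s' \<longleftrightarrow> (case s of (i, j, k) \<Rightarrow> case s' of (i', j', k') \<Rightarrow>
     i < i' \<and> j = j' \<and> k = k' \<or> i = i' \<and> j < j' \<and> k = k' \<or> i = i' \<and> j = j' \<and> k < k')"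

lemma solid_SYT_alt:
  "solid_SYT S = {t \<in> extensional S. bij_betw t S {1..card S} \<and>
     (\<forall>s\<in>S. \<forall>s'\<in>S. cell_less s s' \<longrightarrow> t s < t s')}"
  unfolding solid_SYT_def cell_less_def by (rule Collect_cong) (auto split: prod.splits; blast)

text \<open>The cells that may carry the largest entry.\<close>
definition corners :: "(nat \<times> nat \<times> nat) set \<Rightarrow> (nat \<times> nat \<times> nat) set" where
  "corners S = {s \<in> S. \<forall>s'\<in>S. \<not> cell_less s s'}"

lemma finite_solid_SYT: "finite S \<Longrightarrow> finite (solid_SYT S)"
proof (rule finite_subset)
  show "solid_SYT S \<subseteq> S \<rightarrow>\<^sub>E {1..card S}"
    unfolding solid_SYT_alt PiE_def by (auto dest: bij_betwE)
  show "finite S \<Longrightarrow> finite (S \<rightarrow>\<^sub>E {1..card S})" by (intro finite_PiE) simp_all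
qed

lemma solid_SYT_largest_entry:
  assumes "finite S" "s \<in> corners S"
  shows "bij_betw (\<lambda>t. t(s := card S)) (solid_SYT (S - {s})) {t \<in> solid_SYT S. t s = card S}"
proof (rule bij_betw_byWitness[where f' = "\<lambda>t. t(s := undefined)"])
  have s: "s \<in> S" "\<And>s'. s' \<in> S \<Longrightarrow> \<not> cell_less s s'" using assms(2) by (auto simp: corners_def)
  define n where "n = card (S - {s})"
  have card: "card S = Suc n" unfolding n_def by (rule card.remove[OF assms(1) s(1)])
  have irrefl: "\<not> cell_less s s" by (rule s(2)[OF s(1)])
  show "\<forall>t\<in>solid_SYT (S - {s}). (t(s := card S))(s := undefined) = t"
  proof
    fix t assume "t \<in> solid_SYT (S - {s})"
    then have "t \<in> extensional (S - {s})" by (simp add: solid_SYT_alt)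
    then have "t s = undefined" by (rule extensional_arb) simp
    then show "(t(s := card S))(s := undefined) = t" by auto
  qed
  show "\<forall>t\<in>{t \<in> solid_SYT S. t s = card S}. (t(s := undefined))(s := card S) = t" by auto
  show "(\<lambda>t. t(s := card S)) ` solid_SYT (S - {s}) \<subseteq> {t \<in> solid_SYT S. t s = card S}"
  proof (intro image_subsetI CollectI conjI)
    fix t assume t: "t \<in> solid_SYT (S - {s})"
    then have b: "bij_betw t (S - {s}) {1..n}" by (simp add: solid_SYT_alt n_def)
    have "bij_betw (t(s := Suc n)) ({s} \<union> (S - {s})) ({Suc n} \<union> {1..n})"
    proof (rule bij_betw_combine)
      show "bij_betw (t(s := Suc n)) {s} {Suc n}" by (simp add: bij_betw_def)
      show "bij_betw (t(s := Suc n)) (S - {s}) {1..n}"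
        using b by (subst bij_betw_cong[where g = t]) auto
    qed auto
    moreover have "{s} \<union> (S - {s}) = S" using s(1) by blast
    moreover have "{Suc n} \<union> {1..n} = {1..Suc n}" by auto
    ultimately have "bij_betw (t(s := Suc n)) S {1..Suc n}" by simp
    moreover have "t x < Suc n" if "x \<in> S" "x \<noteq> s" for x
      using bij_betwE[OF b] that by (auto simp: less_Suc_eq_le)
    ultimately show "t(s := card S) \<in> solid_SYT S"
      using t s irrefl unfolding solid_SYT_alt card by (auto simp: extensional_def)
  qed simp
  show "(\<lambda>t. t(s := undefined)) ` {t \<in> solid_SYT S. t s = card S} \<subseteq> solid_SYT (S - {s})"
  proof (intro image_subsetI)
    fix t assume "t \<in> {t \<in> solid_SYT S. t s = card S}"
    then have t: "t \<in> solid_SYT S" "t s = Suc n" by (simp_all add: card)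
    then have b: "bij_betw t S {1..Suc n}" by (simp add: solid_SYT_alt card)
    have "bij_betw t (S - {s}) ({1..Suc n} - {Suc n})"
      using bij_betw_DiffI[OF b, of "{s}" "{Suc n}"] s(1) t(2) by (simp add: bij_betw_def)
    moreover have "{1..Suc n} - {Suc n} = {1..n}" by auto
    ultimately have "bij_betw (t(s := undefined)) (S - {s}) {1..n}"
      by (subst bij_betw_cong[where g = t]) auto
    then show "t(s := undefined) \<in> solid_SYT (S - {s})"
      using t(1) unfolding solid_SYT_alt n_def[symmetric] by (auto simp: extensional_def)
  qed
qed

theorem card_solid_SYT_rec:
  assumes "finite S" "S \<noteq> {}"
  shows "card (solid_SYT S) = (\<Sum>s\<in>corners S. card (solid_SYT (S - {s})))"
proof -
  have fin: "finite (corners S)" using assms(1) by (simp add: corners_def)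
  have "solid_SYT S = (\<Union>s\<in>corners S. {t \<in> solid_SYT S. t s = card S})"
  proof (intro equalityI subsetI)
    fix t assume t: "t \<in> solid_SYT S"
    then have b: "bij_betw t S {1..card S}" by (simp add: solid_SYT_alt)
    have "card S \<in> {1..card S}" using assms by (simp add: Suc_le_eq card_gt_0_iff)
    then obtain s where s: "s \<in> S" "t s = card S" using b by (metis bij_betw_imp_surj_on imageE)
    have "\<not> cell_less s s'" if "s' \<in> S" for s'
    proof
      assume "cell_less s s'"
      then have "t s < t s'" using t s(1) that by (simp add: solid_SYT_alt)
      moreover have "t s' \<le> card S" using bij_betwE[OF b] that by auto
      ultimately show False using s(2) by simp
    qed
    with s(1) have "s \<in> corners S" by (simp add: corners_def)
    with s(2) t show "t \<in> (\<Union>s\<in>corners S. {t \<in> solid_SYT S. t s = card S})"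
      by blast
  qed auto
  also have "card \<dots> = (\<Sum>s\<in>corners S. card {t \<in> solid_SYT S. t s = card S})"
  proof (rule card_UN_disjoint[OF fin])
    show "\<forall>s\<in>corners S. finite {t \<in> solid_SYT S. t s = card S}" 
      using finite_solid_SYT[OF assms(1)] by simp
    show "\<forall>s\<in>corners S. \<forall>s'\<in>corners S. s \<noteq> s' \<longrightarrow>
      {t \<in> solid_SYT S. t s = card S} \<inter> {t \<in> solid_SYT S. t s' = card S} = {}"
    proof (intro ballI impI)
      fix s s' assume "s \<in> corners S" "s' \<in> corners S" "s \<noteq> s'"
      moreover have "s = s'" if "t \<in> solid_SYT S" "t s = card S" "t s' = card S" "s \<in> S" "s' \<in> S" for t
      proof -
        have "inj_on t S" using that(1) by (simp add: solid_SYT_alt bij_betw_def)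
        then show ?thesis by (rule inj_onD) (simp_all add: that)
      qed
      ultimately show "{t \<in> solid_SYT S. t s = card S} \<inter> {t \<in> solid_SYT S. t s' = card S} = {}"
        by (auto simp: corners_def)
    qed
  qed
  also have "\<dots> = (\<Sum>s\<in>corners S. card (solid_SYT (S - {s})))"
    by (rule sum.cong[OF refl]) (rule bij_betw_same_card[OF solid_SYT_largest_entry[OF assms(1)], symmetric])
  finally show ?thesis .
qed

text \<open>
  The cells filled after \<open>a\<close>, \<open>b\<close>, \<open>c\<close> cells of the rows \<open>(1,1)\<close>, \<open>(1,2)\<close>, \<open>(2,1)\<close>; the flag \<open>e\<close> says
  whether \<open>(2,2,1)\<close> is filled too.
\<close>
definition ideal :: "nat \<Rightarrow> nat \<Rightarrow> nat \<Rightarrow> bool \<Rightarrow> (nat \<times> nat \<times> nat) set" where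
  "ideal a b c e = {1} \<times> {1} \<times> {1..a} \<union> {1} \<times> {2} \<times> {1..b} \<union> {2} \<times> {1} \<times> {1..c}
      \<union> (if e then {(2, 2, 1)} else {})"

lemma ideal_iff: "(i, j, k) \<in> ideal a b c e \<longleftrightarrow>
    1 \<le> k \<and> (i = 1 \<and> j = 1 \<and> k \<le> a \<or> i = 1 \<and> j = 2 \<and> k \<le> b \<or> i = 2 \<and> j = 1 \<and> k \<le> c) \<or> e \<and> i = 2 \<and> j = 2 \<and> k = 1"
  by (auto simp: ideal_def)

lemma finite_ideal [simp]: "finite (ideal a b c e)"
  by (simp add: ideal_def)

lemma S_shape_eq: "S_shape n = ideal n n n True"
  by (auto simp: S_shape_def ideal_def)

text \<open>The number of words with \<open>a\<close>, \<open>b\<close>, \<open>c\<close> letters \<open>A\<close>, \<open>B\<close>, \<open>C\<close>, and the letter \<open>D\<close> if \<open>e\<close> holds.\<close>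
definition syt :: "nat \<Rightarrow> nat \<Rightarrow> nat \<Rightarrow> bool \<Rightarrow> nat" where
  "syt a b c e = card (solid_SYT (ideal a b c e))"

lemma g_num_eq: "g_num n = syt n n n True"
  by (simp add: g_num_def syt_def S_shape_eq)

lemma corners_ideal:
  assumes "b \<le> a" "c \<le> a" "e \<Longrightarrow> 1 \<le> b \<and> 1 \<le> c"
  shows "corners (ideal a b c e) = 
    (if b < a \<and> c < a then {(1, 1, a)} else {}) \<union> (if 0 < b \<and> (e \<longrightarrow> 1 < b) then {(1, 2, b)} else {}) \<union>
    (if 0 < c \<and> (e \<longrightarrow> 1 < c) then {(2, 1, c)} else {}) \<union> (if e then {(2, 2, 1)} else {})" (is "_ = ?R")
proof (intro equalityI subsetI)
  fix s assume "s \<in> corners (ideal a b c e)"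
  then obtain i j k where s: "s = (i, j, k)" "(i, j, k) \<in> ideal a b c e"
    and max: "\<And>i' j' k'. (i', j', k') \<in> ideal a b c e \<Longrightarrow> \<not> cell_less (i, j, k) (i', j', k')"
    by (cases s) (auto simp: corners_def)
  have k: "1 \<le> k" using s(2) unfolding ideal_iff by linarith
  from s(2) consider "i = 1" "j = 1" "k \<le> a" | "i = 1" "j = 2" "k \<le> b" | "i = 2" "j = 1" "k \<le> c"
    | "e" "i = 2" "j = 2" "k = 1"
    unfolding ideal_iff by blast
  then show "s \<in> ?R"
  proof cases
    case 1
    have "\<not> k < a" "\<not> k \<le> b" "\<not> k \<le> c"
      using max[of 1 1 a] max[of 1 2 k] max[of 2 1 k] k unfolding 1(1,2) by (auto simp: ideal_iff cell_less_def)
    then have "k = a" "b < a" "c < a" using 1(3) by simp_all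
    with 1 s(1) show ?thesis by simp
  next
    case 2
    have "\<not> k < b" "\<not> (e \<and> k = 1)"
      using max[of 1 2 b] max[of 2 2 1] k unfolding 2(1,2) by (auto simp: ideal_iff cell_less_def)
    then have "k = b" "e \<longrightarrow> 1 < b" using 2(3) k by auto
    with 2 s(1) k show ?thesis by simp
  next
    case 3
    have "\<not> k < c" "\<not> (e \<and> k = 1)"
      using max[of 2 1 c] max[of 2 2 1] k unfolding 3(1,2) by (auto simp: ideal_iff cell_less_def)
    then have "k = c" "e \<longrightarrow> 1 < c" using 3(3) k by auto
    with 3 s(1) k show ?thesis by simp
  next
    case 4
    with s(1) show ?thesis by simp
  qed
next
  fix s assume "s \<in> ?R"
  then consider "s = (1, 1, a)" "b < a" "c < a" | "s = (1, 2, b)" "0 < b" "e \<longrightarrow> 1 < b"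
    | "s = (2, 1, c)" "0 < c" "e \<longrightarrow> 1 < c" | "s = (2, 2, 1)" e
    by (auto split: if_splits)
  then show "s \<in> corners (ideal a b c e)"
    by cases (use assms in \<open>auto simp: corners_def ideal_iff cell_less_def\<close>)
qed

lemma ideal_remove:
  "ideal a b c e - {(1, 1, a)} = ideal (a - 1) b c e"
  "ideal a b c e - {(1, 2, b)} = ideal a (b - 1) c e"
  "ideal a b c e - {(2, 1, c)} = ideal a b (c - 1) e"
  "ideal a b c e - {(2, 2, 1)} = ideal a b c False"
  by (auto simp: ideal_def)

lemma syt_0: "syt 0 0 0 False = 1"
proof -
  have "ideal 0 0 0 False = {}" by (simp add: ideal_def)
  moreover have "solid_SYT {} = {\<lambda>_. undefined}" by (auto simp: solid_SYT_alt bij_betw_def)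
  ultimately show ?thesis by (simp add: syt_def)
qed

lemma syt_rec:
  assumes "b \<le> a" "c \<le> a" "0 < a" "e \<Longrightarrow> 1 \<le> b \<and> 1 \<le> c"
  shows "syt a b c e = (if b < a \<and> c < a then syt (a - 1) b c e else 0) + (if 0 < b \<and> (e \<longrightarrow> 1 < b) then syt a (b - 1) c e else 0)
   + (if 0 < c \<and> (e \<longrightarrow> 1 < c) then syt a b (c - 1) e else 0) + (if e then syt a b c False else 0)"
proof -
  have "ideal a b c e \<noteq> {}" using assms(3) by (auto simp: ideal_def)
  from card_solid_SYT_rec[OF finite_ideal this]
  have "syt a b c e = (\<Sum>s\<in>corners (ideal a b c e). card (solid_SYT (ideal a b c e - {s})))"
    by (simp add: syt_def)
  also have "\<dots> = (if b < a \<and> c < a then syt (a - 1) b c e else 0) + (if 0 < b \<and> (e \<longrightarrow> 1 < b) then syt a (b - 1) c e else 0)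
   + (if 0 < c \<and> (e \<longrightarrow> 1 < c) then syt a b (c - 1) e else 0) + (if e then syt a b c False else 0)"
  proof -
    have sum4: "sum f ((if A then {w} else {}) \<union> (if B then {x} else {}) \<union> (if C then {y} else {}) \<union> (if D then {z} else {}))
      = (if A then f w else 0) + (if B then f x else 0) + (if C then f y else 0) + (if D then f z else 0)"
      if "distinct [w, x, y, z]" for f :: "nat \<times> nat \<times> nat \<Rightarrow> nat" and w x y z A B C D
      using that by auto
    have "corners (ideal a b c e) = 
      (if b < a \<and> c < a then {(1, 1, a)} else {}) \<union> (if 0 < b \<and> (e \<longrightarrow> 1 < b) then {(1, 2, b)} else {}) \<union>
      (if 0 < c \<and> (e \<longrightarrow> 1 < c) then {(2, 1, c)} else {}) \<union> (if e then {(2, 2, 1)} else {})"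
      using assms by (intro corners_ideal) auto
    then show ?thesis
      by (simp only:) (subst sum4, simp, simp only: ideal_remove syt_def)
  qed
  finally show ?thesis .
qed

section \<open>Polynomial identities behind the explicit solutions\<close>

text \<open>
  The variables \<open>u\<close> and \<open>v\<close> with \<open>x = u (2 - W\<^sup>2u)\<close>, \<open>y = v (2 - W\<^sup>2v)\<close> rationalise the square roots
  \<open>p\<close> and \<open>q\<close>. Here \<open>kw\<close> is \<open>w\<close> times the kernel, since \<open>W = tw\<close>. Dividing by \<open>Wxy\<close>, the identity says
  that \<open>(1/W - 1/x) p + (1/W - 1/y) q\<close> is a multiple of the kernel. It comes from the factorisation
  \<open>W kw = (1 + pq - xyW) (xyW - 1 + pq)\<close>.
\<close>
lemma kernel_factor_id:
  fixes W u v :: "'a::idom"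
  assumes "x = u * (2 - W^2*u)" "y = v * (2 - W^2*v)" "p = 1 - W^2*u" "q = 1 - W^2*v" "w = 2 + W^3"
    "den = 1 + p*q - x*y*W" "kw = w*x*y - W*(x + y + x^2*y^2)"
  shows "den * (y*(x-W)*p + x*(y-W)*q) = kw * (p+q)"
  unfolding assms by algebra

text \<open>
  The source is \<open>1\<close>: \<open>K = w (PQ - W\<^sup>3) / (PQ den)\<close>, \<open>F(x) = w (2P - W\<^sup>3) / (2P\<^sup>2)\<close>.
\<close>
lemma kreweras_kernel_id:
  fixes W u v :: "'a::idom"
  assumes "x = u * P" "y = v * Q" "P = 2 - W^2*u" "Q = 2 - W^2*v" "p = 1 - W^2*u" "q = 1 - W^2*v" "w = 2 + W^3"
    "den = 1 + p*q - x*y*W" "kw = w*x*y - W*(x + y + x^2*y^2)"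
  shows "den * (2*w*x*y*P^2*Q^2 - W*x*Q^2*w*(2*P - W^3) - W*y*P^2*w*(2*Q - W^3)) 
    = 2*kw*w*(P*Q-W^3)*P*Q"
  unfolding assms by algebra

text \<open>
  The sources of words in two letters. Here \<open>ex / (W x\<^sup>2)\<close> is the invariant \<open>x + 1/(tx) - 1/x\<^sup>2\<close>, and
  \<open>Gx / (2 W\<^sup>3 x\<^sup>3)\<close> is \<open>tx F(x) + x\<^sup>2 d(x)\<close>, where \<open>d\<close> is the Catalan series of \<open>t\<^sup>2x\<close>. The constant \<open>m\<close> is
  arbitrary here; \<open>ballot_boundary_id\<close> fixes it by the absence of a pole at \<open>x = 0\<close>.
\<close>
lemma ballot_kernel_id:
  fixes W u v m x y :: "'a::idom"
  assumes "w = 2 + W^3" "kw = w*x*y - W*(x + y + x^2*y^2)"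
    "ex = W*x^3+w*x-W" "ey = W*y^3+w*y-W"
    "Gx = w^2*x*ex-3*w*W^2*x^3-2*w*W*(w*x-W)-2*w*(ex-m*W*x^2)*(x-W)*p"
    "Gy = w^2*y*ey-3*w*W^2*y^3-2*w*W*(w*y-W)-2*w*(ey-m*W*y^2)*(y-W)*q"
    "Br = den*(2*W*(x+y)*x^2*y^2+w*x*y*(x+y)-2*W*(x+y)^2+6*W*x*y-(y-x)*(y*(x-W)*p-x*(y-W)*q))-(p+q)*(y^2*ex+x^2*ey-2*W*m*x^2*y^2)"
    "den * (y*(x-W)*p + x*(y-W)*q) = kw * (p+q)"
  shows "w*kw*Br+den*(2*W^2*x^3*y^3*w*x*y*(x+y)-y^3*Gx-x^3*Gy) = 0"
  using assms(8) unfolding assms(1-7) by algebra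

text \<open>
  The same boundary function in a form without denominators in \<open>x\<close>, \<open>W\<close> and \<open>t\<close>, which shows that it
  is a power series. Here \<open>g = 1 / (2 - W\<^sup>2u)\<close>.
\<close>
lemma ballot_boundary_id:
  fixes W x w t d g F V G p e m :: "'a::idom"
  assumes w: "w = 2 + W^3" and g: "g * P = 1" and x: "x = u*P" and P: "P = 2 - W^2*u" and p: "p = 1 - W^2*u"
   and d: "d = 1+t^2*x*d^2" and W: "W = t*w" and V: "V = W^3"
   and e: "e = W*x^3+w*x-W" and m: "8 * m = W^4 - 4*W"
   and G: "G = w^2*x*e-3*w*W^2*x^3-2*w*W*(w*x-W)-2*w*(e-m*W*x^2)*(x-W)*p"
   and F: "16*F = w^2*(V^2*g^2*(2*g^2+2*g+1) - 2*V*g^2*(2*g+1)) - w^3*(2*V*g^2*(2*g+1) - 8*g^2)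
      + w^2*(V - 4)*(V*g^2 - 2*g) - x*(8*w^2*W^2*g^2 - 8*w*W^2 - 8*w^2*W*x*g^2 + 16*t*x*d^2)"
  shows "16*w*G = 16*2*W^3*x^3*(W*x*F + w*x^2*d)"
proof -
  define F' where "F' = 16*F + x*16*t*x*d^2"
  have "F' * P^4 = w^2*(V^2*(2+2*P+P^2) - 2*V*(2*P+P^2)) - w^3*(2*V*(2*P+P^2) - 8*P^2)
      + w^2*(V - 4)*(V*P^2 - 2*P^3) - x*(8*w^2*W^2*P^2 - 8*w*W^2*P^4 - 8*w^2*W*x*P^2)"
  proof -
    have 1: "g^2*P^4 = P^2" "g^3*P^4 = P" "g^4*P^4=1" "g*P^4=P^3" using g by algebra+
    have "F' * P^4 = w^2*(V^2*(2*(g^4*P^4)+2*(g^3*P^4)+g^2*P^4) - 2*V*(2*(g^3*P^4)+(g^2*P^4))) - w^3*(2*V*(2*(g^3*P^4)+(g^2*P^4)) - 8*(g^2*P^4))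
      + w^2*(V - 4)*(V*(g^2*P^4) - 2*(g*P^4)) - x*(8*w^2*W^2*(g^2*P^4) - 8*w*W^2*P^4 - 8*w^2*W*x*(g^2*P^4))"
      unfolding F'_def F by algebra
    then show ?thesis unfolding 1 by simp
  qed
  then have "(16*w*G) * P^4 = 2*W^3*x^3*(W*x*F' + 16*w*x^2) * P^4"
  proof -
    assume a: "F' * P^4 = w^2*(V^2*(2+2*P+P^2) - 2*V*(2*P+P^2)) - w^3*(2*V*(2*P+P^2) - 8*P^2)
      + w^2*(V - 4)*(V*P^2 - 2*P^3) - x*(8*w^2*W^2*P^2 - 8*w*W^2*P^4 - 8*w^2*W*x*P^2)"
    have "2*W^3*x^3*(W*x*F' + 16*w*x^2) * P^4 = 2*W^3*x^3*(W*x*(F'*P^4) + 16*w*x^2* P^4)"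
      by algebra
    also have "\<dots> = (16*w*G) * P^4"
    proof -
      have "16*w*G = 16*w*(w^2*x*e-3*w*W^2*x^3-2*w*W*(w*x-W)-2*w*(e)*(x-W)*p) + 4*w*w*(W^4-4*W)*W*x^2*(x-W)*p"
        using m unfolding G by algebra
      then show ?thesis unfolding a V e x w p unfolding P by algebra
    qed
    finally show ?thesis ..
  qed
  moreover have "P^4 \<noteq> 0" using g by auto
  ultimately have "16*w*G = 2*W^3*x^3*(W*x*F' + 16*w*x^2)" by simp
  also have "\<dots> = 16*2*W^3*x^3*(W*x*F + w*x^2*d)"
    unfolding F'_def W using d by algebra
  finally show ?thesis .
qed

text \<open>
  The source of the words in \<open>A\<close> only. The right-hand side vanishes at \<open>x = t\<close>, where \<open>\<pi> = p\<rho>\<close> (with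
  \<open>r\<close> for \<open>\<rho>\<close>) takes the value \<open>1\<close>; the defining equation of \<open>F\<close> is what remains after division by
  \<open>x - t\<close> and by \<open>t\<^sup>3\<close>, using \<open>\<pi>\<^sup>2 - 1 = - W\<^sup>2 r\<^sup>2 (x - t)\<close>.
\<close>
lemma diagonal_boundary_id:
  fixes x t r \<pi> F :: "'a::idom"
  assumes r: "4*r^6*t^3 = r^2 - 1" and p: "\<pi>^2 = r^2 - 4*r^6*t^2*x" and W: "W = 2*r^2*t"
    and Th: "\<Theta> = 2*r^4+r^2+1"
    and F: "F*(1+t*x^2)*(\<pi>+1)^2 = x*(2*r^6*(2*r^2+3)*t^2*(\<pi>+1)+4*r^6*t*(x-t)) + r^2*((2*r^2+1)*(\<pi>+1)-\<Theta>)*(\<pi>+1)"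
    and nz: "\<pi> + 1 \<noteq> 0"
  shows "8*r^6*t^3*((x-t)*(1+t*x^2))*F = 4*r^6*(x-2*t+t^3*x-2*t^2*x^2) - \<Theta>*(x-W)*\<pi>"
proof -
  have "8*r^6*t^3*((x-t)*(1+t*x^2))*F*(\<pi>+1)^2 
      = 8*r^6*t^3*(x-t)*(x*(2*r^6*(2*r^2+3)*t^2*(\<pi>+1)+4*r^6*t*(x-t)) + r^2*((2*r^2+1)*(\<pi>+1)-\<Theta>)*(\<pi>+1))"
    using F by algebra
  also have "\<dots> = (4*r^6*(x-2*t+t^3*x-2*t^2*x^2) - \<Theta>*(x-W)*\<pi>)*(\<pi>+1)^2"
    unfolding W Th using r p by algebra
  finally show ?thesis using nz by simp
qed

text \<open>
  Cleared of denominators, the rational part of the right-hand side of the functional equation is \<open>kappa * R\<close>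
  (up to a factor); the part containing the square roots is a multiple of the kernel by
  \<open>kernel_factor_id\<close>.
\<close>
lemma diagonal_kernel_id:
  fixes x y t :: "'a::idom"
  assumes "kappa = x*y - t*(x+y+x^2*y^2)"
   "dx = (x-t)*(1+t*x^2)" "dy = (y-t)*(1+t*y^2)"
   "W = t*w" "kw = w * kappa"
   and half: "den * (y*(x-W)*p + x*(y-W)*q) = kw * (p+q)"
   "\<alpha> = (x-W)*p" "\<beta> = (y-W)*q"
   "R = 2*x^2*y^2*t^3 - x^2*y*t^4 - x^2*y*t + 2*x^2*t^2 - x*y^2*t^4 - x*y^2*t - x*t^3 - x + 2*y^2*t^2 - y*t^3 - y + 2*t"
   and Fx: "8*r^6*t^3*dx*Fx = 4*r^6*(x-2*t+t^3*x-2*t^2*x^2) - \<Theta>*(x-W)*(p*r)"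
   and Fy: "8*r^6*t^3*dy*Fy = 4*r^6*(y-2*t+t^3*y-2*t^2*y^2) - \<Theta>*(y-W)*(q*r)"
   and I: "I1*(1-t*x*y) = 1"
  shows "kappa * (8*x*y*den*r^6*t*R + (1-t*x*y)*t*\<Theta>*r*((x^2*dy+y^2*dx)*w*(p+q) + den*(x-y)*(y*\<alpha>-x*\<beta>)))
    = 16*r^6*t^3*x*y*den*dx*dy*(1-t*x*y)*(x*y*I1 - t*x*Fx - t*y*Fy)"
proof -
  define nx where "nx = x-2*t+t^3*x-2*t^2*x^2"
  define ny where "ny = y-2*t+t^3*y-2*t^2*y^2"
  have d: "x^2*dy - y^2*dx = (x-y)*kappa" unfolding assms by algebra
  have R: "kappa*R = 2*t^2*dx*dy*x*y - (1-t*x*y)*(x*nx*dy+y*ny*dx)"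
    unfolding assms nx_def ny_def by algebra
  have B: "2*x*y*den*(x*\<alpha>*dy + y*\<beta>*dx) = kappa * ((x^2*dy+y^2*dx)*w*(p+q) + den*(x-y)*(y*\<alpha>-x*\<beta>))"
  proof -
    have "den*(y*\<alpha>+x*\<beta>) = w*kappa*(p+q)" using half unfolding assms(5,7,8) by (simp add: algebra_simps)
    then show ?thesis using d by algebra
  qed
  have "16*r^6*t^3*x*y*den*dx*dy*(1-t*x*y)*(x*y*I1 - t*x*Fx - t*y*Fy)
     = 2*x*y*den*((8*r^6*t^3*dx*dy*x*y*(I1*(1-t*x*y)) - (1-t*x*y)*t*(x*(8*r^6*t^3*dx*Fx)*dy + y*(8*r^6*t^3*dy*Fy)*dx)))"
    by algebra
  also have "\<dots> = 2*x*y*den*((8*r^6*t^3*dx*dy*x*y - (1-t*x*y)*t*(x*(4*r^6*nx - \<Theta>*\<alpha>*r)*dy + y*(4*r^6*ny - \<Theta>*\<beta>*r)*dx)))"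
    unfolding I Fx Fy nx_def ny_def assms(7,8) by algebra
  also have "\<dots> = kappa * (8*x*y*den*r^6*t*R + (1-t*x*y)*t*\<Theta>*r*((x^2*dy+y^2*dx)*w*(p+q) + den*(x-y)*(y*\<alpha>-x*\<beta>)))"
    using R B by algebra
  finally show ?thesis by simp
qed

section \<open>Power series in three variables\<close>

text \<open>
  Series in \<open>x\<close>, \<open>y\<close>, \<open>t\<close> are iterated formal power series, with \<open>y\<close> outermost and \<open>t\<close> innermost; the
  coefficient of \<open>x\<^sup>i y\<^sup>j t\<^sup>m\<close> is \<open>f $ j $ i $ m\<close>. The automorphism \<open>swap\<close> exchanges \<open>x\<close> and \<open>y\<close>.
\<close>
definition swap :: "'a::comm_ring_1 fps fps \<Rightarrow> 'a fps fps" where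
  "swap f = Abs_fps (\<lambda>i. Abs_fps (\<lambda>j. f $ j $ i))"

lemma swap_nth [simp]: "swap f $ i $ j = f $ j $ i"
  by (simp add: swap_def)

lemma fps2_eqI: "(\<And>i j. f $ i $ j = g $ i $ j) \<Longrightarrow> f = (g :: 'a::comm_ring_1 fps fps)"
  by (simp add: fps_eq_iff)

lemma swap_add: "swap (f + g) = swap f + swap g"
  by (rule fps2_eqI) simp

lemma swap_diff: "swap (f - g) = swap f - swap g"
  by (rule fps2_eqI) simp

lemma swap_mult: "swap (f * g) = swap f * swap g"
proof (rule fps2_eqI)
  fix i j
  show "swap (f * g) $ i $ j = (swap f * swap g) $ i $ j"
    by (simp add: fps_mult_nth fps_sum_nth) (rule sum.swap)
qed

lemma swap_const_const [simp]: "swap (fps_const (fps_const c)) = fps_const (fps_const c)"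
  by (rule fps2_eqI) simp

lemma swap_1 [simp]: "swap 1 = 1"
  by (rule fps2_eqI) simp

lemma swap_numeral [simp]: "swap (numeral n) = numeral n"
  by (simp only: numeral_fps_const swap_const_const)

lemma swap_power: "swap (f ^ n) = swap f ^ n"
  by (induction n) (simp_all add: swap_mult)

lemma swap_X [simp]: "swap fps_X = fps_const fps_X"
  by (rule fps2_eqI) (simp add: fps_X_def)

lemma swap_swap [simp]: "swap (swap f) = f"
  by (rule fps2_eqI) simp

lemma swap_const_X [simp]: "swap (fps_const fps_X) = fps_X"
  by (metis swap_X swap_swap)

lemma swap_dvd: "swap d dvd swap f \<longleftrightarrow> d dvd f"
  by (metis dvd_def swap_mult swap_swap)

lemmas swap_simps = swap_add swap_diff swap_mult swap_power

lemma fps_unitI: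
  fixes f :: "'a::comm_ring_1 fps"
  assumes "f $ 0 dvd 1"
  shows "f dvd 1"
proof -
  obtain c where "1 = f $ 0 * c" using assms by (rule dvdE)
  then have "f * fps_right_inverse f c = 1" by (intro fps_right_inverse) simp
  then show ?thesis by (metis dvd_triv_left)
qed

text \<open>The coefficients of the solution \<open>f\<close> of \<open>f = h + \<beta> X f\<^sup>2\<close>.\<close>
fun quadratic_coeff :: "'a::comm_ring_1 \<Rightarrow> 'a \<Rightarrow> nat \<Rightarrow> 'a" where
  "quadratic_coeff h \<beta> 0 = h"
| "quadratic_coeff h \<beta> (Suc n) = \<beta> * (\<Sum>i\<le>n. quadratic_coeff h \<beta> i * quadratic_coeff h \<beta> (n - i))"

definition quadratic_series :: "'a::comm_ring_1 \<Rightarrow> 'a \<Rightarrow> 'a fps" where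
  "quadratic_series h \<beta> = Abs_fps (quadratic_coeff h \<beta>)"

lemma quadratic_series_nth_0 [simp]: "quadratic_series h \<beta> $ 0 = h"
  by (simp add: quadratic_series_def)

lemma quadratic_series: "quadratic_series h \<beta> = fps_const h + fps_const \<beta> * (fps_X * (quadratic_series h \<beta>)^2)"
proof (rule fps_ext)
  fix n
  have "((quadratic_series h \<beta>)^2) $ m = (\<Sum>i\<le>m. quadratic_coeff h \<beta> i * quadratic_coeff h \<beta> (m - i))" for m
    by (simp add: quadratic_series_def power2_eq_square fps_mult_nth atLeast0AtMost)
  then show "quadratic_series h \<beta> $ n = (fps_const h + fps_const \<beta> * (fps_X * (quadratic_series h \<beta>)^2)) $ n"
    by (cases n) (simp_all add: quadratic_series_def)
qed

type_synonym ser3 = "rat fps fps fps"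

definition tt :: ser3 where "tt = fps_const (fps_const fps_X)"
definition xx :: ser3 where "xx = fps_const fps_X"
definition yy :: ser3 where "yy = fps_X"

lemma swap_vars [simp]: "swap tt = tt" "swap xx = yy" "swap yy = xx"
  by (simp_all add: tt_def xx_def yy_def)

lemma var_mult_nth [simp]:
  "(tt * f) $ j $ i = fps_X * (f $ j $ i)" 
  "(xx * f) $ j = fps_X * (f $ j)"
  "(yy * f) $ j = (if j = 0 then 0 else f $ (j - 1))"
  by (simp_all add: tt_def xx_def yy_def)

lemma var_nth [simp]:
  "tt $ j = (if j = 0 then fps_const fps_X else 0)" 
  "xx $ j = (if j = 0 then fps_X else 0)"
  "yy $ j = (if j = 1 then 1 else 0)"
  by (simp_all add: tt_def xx_def yy_def fps_X_def)

lemma vars_nonzero [simp]: "tt \<noteq> 0" "xx \<noteq> 0" "yy \<noteq> 0"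
  by (simp_all add: tt_def xx_def yy_def)

text \<open>The kernel of the steps \<open>(1,1)\<close>, \<open>(-1,0)\<close>, \<open>(0,-1)\<close>, multiplied by \<open>xy\<close>.\<close>
definition kernel :: ser3 where "kernel = xx*yy - tt*(xx + yy + xx^2*yy^2)"

lemma swap_kernel [simp]: "swap kernel = kernel"
  unfolding kernel_def swap_simps swap_vars by algebra

text \<open>The value at \<open>t = 0\<close>.\<close>
definition at_t_0 :: "ser3 \<Rightarrow> rat fps fps" where
  "at_t_0 f = Abs_fps (\<lambda>j. Abs_fps (\<lambda>i. f $ j $ i $ 0))"

lemma at_t_0_nth [simp]: "at_t_0 f $ j $ i = f $ j $ i $ 0"
  by (simp add: at_t_0_def)

lemma at_t_0_mult: "at_t_0 (f * g) = at_t_0 f * at_t_0 g"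
  by (rule fps2_eqI) (simp add: fps_mult_nth fps_sum_nth)

lemma tt_dvd_iff: "tt dvd f \<longleftrightarrow> at_t_0 f = 0"
proof
  assume "tt dvd f"
  then obtain g where "f = tt * g" by (rule dvdE)
  then show "at_t_0 f = 0" by (intro fps2_eqI) simp
next
  assume *: "at_t_0 f = 0"
  define g where "g = Abs_fps (\<lambda>j. Abs_fps (\<lambda>i. fps_shift 1 (f $ j $ i)))"
  have "f $ j $ i = fps_X * fps_shift 1 (f $ j $ i)" for i j
  proof -
    have "f $ j $ i $ 0 = 0" using * by (metis at_t_0_nth fps_zero_nth)
    then show ?thesis by (intro fps_ext) (simp add: fps_X_mult_nth)
  qed
  then have "f = tt * g" by (intro fps2_eqI) (simp add: g_def)
  then show "tt dvd f" by simp
qed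

text \<open>
  \<open>d\<close> is coprime to the kernel, in the form in which it is used: a divisor \<open>d\<close> of a multiple of the
  kernel divides the cofactor.
\<close>
definition cancels :: "ser3 \<Rightarrow> bool" where
  "cancels d \<longleftrightarrow> d \<noteq> 0 \<and> (\<forall>f. d dvd kernel * f \<longrightarrow> d dvd f)"

lemma cancelsI:
  assumes "d \<noteq> 0" "\<And>f. d dvd kernel * f \<Longrightarrow> d dvd f"
  shows "cancels d"
  using assms unfolding cancels_def by blast

lemma cancelsD: "cancels d \<Longrightarrow> d dvd kernel * f \<Longrightarrow> d dvd f"
  unfolding cancels_def by blast

lemma cancels_nonzero: "cancels d \<Longrightarrow> d \<noteq> 0"
  unfolding cancels_def by blast

lemma cancels_mult:
  assumes d: "cancels d" and e: "cancels e"
  shows "cancels (d * e)"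
proof (rule cancelsI)
  show "d * e \<noteq> 0"
    by (rule no_zero_divisors[OF cancels_nonzero[OF d] cancels_nonzero[OF e]])
  fix f assume f: "d * e dvd kernel * f"
  then have "d dvd f" by (rule cancelsD[OF d dvd_mult_left])
  then obtain g where g: "f = d * g" by (rule dvdE)
  from f have "d * e dvd d * (kernel * g)" unfolding g by (simp only: mult.left_commute)
  then have "e dvd kernel * g" using cancels_nonzero[OF d] by (simp only: dvd_mult_cancel_left simp_thms)
  then have "e dvd g" by (rule cancelsD[OF e])
  then show "d * e dvd f" unfolding g by (rule mult_dvd_mono[OF dvd_refl])
qed

lemma cancels_unit:
  assumes "d dvd 1" shows "cancels d"
proof (rule cancelsI)
  show "d \<noteq> 0" using assms by auto
  show "d dvd f" for f using dvd_trans[OF assms one_dvd] .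
qed

lemma cancels_power: "cancels d \<Longrightarrow> cancels (d ^ n)"
  by (induction n) (simp_all add: cancels_mult cancels_unit)

lemma cancels_swap:
  assumes d: "cancels d" shows "cancels (swap d)"
proof (rule cancelsI)
  have "swap 0 = (0 :: ser3)" by (rule fps2_eqI) simp
  then show "swap d \<noteq> 0" using cancels_nonzero[OF d] by (metis swap_swap)
next
  fix f assume f: "swap d dvd kernel * f"
  have "swap (swap d) dvd swap (kernel * f)" unfolding swap_dvd by (rule f)
  then have "d dvd kernel * swap f" by (simp only: swap_mult swap_kernel swap_swap)
  then have "d dvd swap f" by (rule cancelsD[OF d])
  then show "swap d dvd f" by (metis swap_dvd swap_swap)
qed

lemma cancels_yy: "cancels yy"
proof (rule cancelsI)
  have dvd: "yy dvd f \<longleftrightarrow> f $ 0 = 0" for f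
  proof
    assume "f $ 0 = 0"
    then have "f = yy * fps_shift 1 f" by (intro fps_ext) simp
    then show "yy dvd f" by (rule dvdI)
  qed (auto simp: dvd_def)
  fix f assume "yy dvd kernel * f"
  then have "kernel $ 0 * f $ 0 = 0" by (simp add: dvd)
  moreover have "kernel $ 0 = - (fps_const fps_X * fps_X)" by (simp add: kernel_def power2_eq_square mult.assoc)
  ultimately show "yy dvd f" by (simp add: dvd)
qed simp

lemma cancels_xx: "cancels xx"
  using cancels_swap[OF cancels_yy] by simp

lemma cancels_tt: "cancels tt"
proof (rule cancelsI)
  fix f assume "tt dvd kernel * f"
  then have "at_t_0 kernel * at_t_0 f = 0" unfolding tt_dvd_iff at_t_0_mult .
  moreover have "at_t_0 kernel = fps_const fps_X * fps_X"
  proof (rule fps2_eqI)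
    fix i j
    have "at_t_0 kernel $ j $ i = (fps_X * (yy $ j)) $ i $ 0"
      unfolding kernel_def at_t_0_nth fps_sub_nth var_mult_nth by simp
    then show "at_t_0 kernel $ j $ i = (fps_const fps_X * fps_X) $ j $ i"
      by simp
  qed
  ultimately show "tt dvd f" unfolding tt_dvd_iff by simp
qed simp

lemma one_plus_tt_unit: "1 + tt * f dvd 1" "1 - tt * f dvd 1"
  by (intro fps_unitI; simp)+

lemma xx_minus_tt_dvd_tt_mult: "xx - tt dvd tt * f \<Longrightarrow> xx - tt dvd f"
proof -
  assume "xx - tt dvd tt * f"
  then obtain g where g: "tt * f = (xx - tt) * g" by (rule dvdE)
  have "at_t_0 (xx - tt) * at_t_0 g = 0"
    unfolding at_t_0_mult[symmetric] g[symmetric] tt_dvd_iff[symmetric] by simp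
  moreover have "at_t_0 (xx - tt) = fps_const fps_X" by (rule fps2_eqI) simp
  ultimately have "at_t_0 g = 0" by simp
  then obtain h where "g = tt * h" unfolding tt_dvd_iff[symmetric] by (rule dvdE)
  with g have "f = (xx - tt) * h" by (simp add: mult.left_commute)
  then show ?thesis by simp
qed

text \<open>Modulo \<open>x - t\<close>, the kernel is \<open>- t\<^sup>2 (1 + t y\<^sup>2)\<close>.\<close>
lemma cancels_xx_minus_tt: "cancels (xx - tt)"
proof (rule cancelsI)
  fix f assume *: "xx - tt dvd kernel * f"
  have "kernel * f = (xx - tt) * ((yy - tt - tt*yy^2*(xx + tt)) * f) - (1 + tt*yy^2) * (tt * (tt * f))"
    unfolding kernel_def by algebra
  then have "(1 + tt*yy^2) * (tt * (tt * f)) = (xx - tt) * ((yy - tt - tt*yy^2*(xx + tt)) * f) - kernel * f"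
    by simp
  with * have "xx - tt dvd (1 + tt*yy^2) * (tt * (tt * f))"
    by (simp only: dvd_diff dvd_triv_left)
  moreover obtain c where "1 = (1 + tt*yy^2) * c" using one_plus_tt_unit(1) by (rule dvdE)
  ultimately have "xx - tt dvd c * ((1 + tt*yy^2) * (tt * (tt * f)))"
    by (simp only: dvd_mult)
  also have "c * ((1 + tt*yy^2) * (tt * (tt * f))) = ((1 + tt*yy^2) * c) * (tt * (tt * f))"
    by (simp only: mult_ac)
  also have "\<dots> = tt * (tt * f)"
    unfolding \<open>1 = (1 + tt*yy^2) * c\<close> [symmetric] by simp
  finally have "xx - tt dvd tt * (tt * f)" .
  then show "xx - tt dvd f" by (blast dest: xx_minus_tt_dvd_tt_mult)
qed (auto dest: arg_cong[where f = "\<lambda>f. f $ 0 $ 1"])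

lemma cancels_divide:
  assumes "cancels d" "kernel * f = d * e"
  shows "\<exists>g. kernel * g = e"
proof -
  have "d dvd f" "d \<noteq> 0" using assms unfolding cancels_def by (metis dvd_triv_left)+
  then obtain g where "f = d * g" by auto
  with assms(2) \<open>d \<noteq> 0\<close> show ?thesis by (auto simp: mult.left_commute)
qed

text \<open>
  The functional equation of walks with starting weights \<open>I\<close>. Both boundary terms contain the same series
  \<open>F\<close>: only sources symmetric in \<open>x\<close> and \<open>y\<close> occur.
\<close>
definition boundary_eq :: "ser3 \<Rightarrow> ser3 \<Rightarrow> rat fps fps \<Rightarrow> bool" where
  "boundary_eq I K F \<longleftrightarrow> kernel * K = xx*yy*I - tt*xx*fps_const F - tt*yy*swap (fps_const F)"

lemma boundary_eq_diff: "boundary_eq I K F \<Longrightarrow> boundary_eq I' K' F' \<Longrightarrow> boundary_eq (I - I') (K - K') (F - F')"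
  unfolding boundary_eq_def fps_const_sub [symmetric] swap_diff by algebra

lemma boundary_eq_boundary: 
  assumes "boundary_eq I K F" shows "K $ 0 = F"
proof -
  have "(kernel * K) $ 0 = (xx*yy*I - tt*xx*fps_const F - tt*yy*swap (fps_const F)) $ 0"
    using assms by (simp add: boundary_eq_def)
  then have "(fps_const fps_X * fps_X) * (K $ 0) = (fps_const fps_X * fps_X) * F"
    by (simp add: kernel_def power2_eq_square)
  then show ?thesis by simp
qed

text \<open>The coefficients count walks: the last step came from \<open>(i+1,j)\<close>, \<open>(i,j+1)\<close> or \<open>(i-1,j-1)\<close>.\<close>
lemma boundary_eq_nth:
  assumes "boundary_eq I K F"
  shows "K $ j $ i $ m = I $ j $ i $ m + (if m = 0 then 0 else
     K $ j $ Suc i $ (m - 1) + K $ Suc j $ i $ (m - 1) + 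
     (if i = 0 \<or> j = 0 then 0 else K $ (j - 1) $ (i - 1) $ (m - 1)))"
proof -
  have e: "(yy * (xx * K) - tt * (yy * K) - tt * (xx * K) - tt * (yy * (yy * (xx * (xx * K))))) $ Suc j $ Suc i $ m
    = (yy * (xx * I) - tt * (xx * fps_const F) - tt * (yy * swap (fps_const F))) $ Suc j $ Suc i $ m"
  proof -
    have "yy * (xx * K) - tt * (yy * K) - tt * (xx * K) - tt * (yy * (yy * (xx * (xx * K)))) = kernel * K"
      unfolding kernel_def by algebra
    also have "\<dots> = xx*yy*I - tt*xx*fps_const F - tt*yy*swap (fps_const F)"
      using assms unfolding boundary_eq_def .
    also have "\<dots> = yy * (xx * I) - tt * (xx * fps_const F) - tt * (yy * swap (fps_const F))"
      by algebra
    finally show ?thesis by (rule arg_cong)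
  qed
  show ?thesis
    using e by (cases m; cases i; cases j) (simp_all add: eq_diff_eq diff_eq_eq)
qed

section \<open>Explicit solutions of the functional equation\<close>
lemma fps2_unitI: "(f :: rat fps fps) $ 0 $ 0 \<noteq> 0 \<Longrightarrow> f dvd 1"
  by (intro fps_unitI) (simp add: dvd_field_iff)

lemma ser3_unitI: "(f :: ser3) $ 0 $ 0 $ 0 \<noteq> 0 \<Longrightarrow> f dvd 1"
  by (intro fps_unitI fps2_unitI)

text \<open>Series in \<open>x\<close> and \<open>t\<close>, in \<open>y\<close> and \<open>t\<close>, and in \<open>t\<close> as series in three variables.\<close>
definition lift_x :: "rat fps fps \<Rightarrow> ser3" where "lift_x = fps_const"
definition lift_y :: "rat fps fps \<Rightarrow> ser3" where "lift_y f = swap (lift_x f)"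
definition lift_t :: "rat fps \<Rightarrow> ser3" where "lift_t c = lift_x (fps_const c)"

lemma lift_x_hom:
  "lift_x (f + g) = lift_x f + lift_x g" "lift_x (f - g) = lift_x f - lift_x g" "lift_x (f * g) = lift_x f * lift_x g" "lift_x (f ^ n) = lift_x f ^ n"
  "lift_x 1 = 1" "lift_x (numeral k) = numeral k" "lift_x fps_X = xx" "lift_x (fps_const c) = lift_t c" "lift_t fps_X = tt"
  unfolding lift_x_def lift_t_def by (simp_all add: xx_def tt_def numeral_fps_const)

lemma swap_lift_t [simp]: "swap (lift_t c) = lift_t c"
  by (simp add: lift_t_def lift_x_def)

lemma lift_y_hom:
  "lift_y (f + g) = lift_y f + lift_y g" "lift_y (f - g) = lift_y f - lift_y g" "lift_y (f * g) = lift_y f * lift_y g" "lift_y (f ^ n) = lift_y f ^ n"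
  "lift_y 1 = 1" "lift_y (numeral k) = numeral k" "lift_y fps_X = yy" "lift_y (fps_const c) = lift_t c"
  unfolding lift_y_def by (simp_all add: lift_x_hom swap_simps)

lemma swap_lift [simp]: "swap (lift_x f) = lift_y f" "swap (lift_y f) = lift_x f"
  by (simp_all add: lift_y_def)

lemma lift_t_hom:
  "lift_t (c + d) = lift_t c + lift_t d" "lift_t (c - d) = lift_t c - lift_t d" "lift_t (c * d) = lift_t c * lift_t d" "lift_t (c ^ n) = lift_t c ^ n"
  "lift_t 1 = 1" "lift_t (numeral k) = numeral k"
  unfolding lift_t_def lift_x_hom(8)[symmetric] by (simp_all add: lift_x_def numeral_fps_const flip: fps_const_mult fps_const_add fps_const_sub fps_const_power)

lemma ser3_nth_0:
  "lift_x f $ 0 $ 0 = f $ 0" "lift_y f $ 0 $ 0 = f $ 0" "lift_t c $ 0 $ 0 = c"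
  "xx $ 0 $ 0 = 0" "yy $ 0 $ 0 = 0" "tt $ 0 $ 0 = fps_X"
  by (simp_all add: lift_y_def lift_x_def lift_t_def)

lemma boundary_eqI:
  assumes "cancels d" "kernel * f = d * (xx*yy*I - tt*xx*lift_x F - tt*yy*lift_y F)"
  shows "\<exists>K. boundary_eq I K F"
  using cancels_divide[OF assms] unfolding boundary_eq_def lift_x_def lift_y_def .

text \<open>
  The series \<open>\<rho> = \<surd>b\<close> with \<open>b = 1 + 4 t\<^sup>3 b\<^sup>3\<close>, and the algebraic series built from it. Those named \<open>u\<close>,
  \<open>P\<close>, \<open>p\<close> are series in \<open>x\<close> and \<open>t\<close>: \<open>p\<close> is the square root of \<open>1 - W\<^sup>2x\<close>, and \<open>u\<close>, \<open>P = 1 / \<gamma>\<close> come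
  from the parametrisation \<open>x = uP\<close>, \<open>P = 2 - W\<^sup>2u\<close>.
\<close>
locale kernel_param =
  fixes \<rho> :: "rat fps"
  assumes rho: "4 * \<rho>^6 * fps_X^3 = \<rho>^2 - 1" and rho_0 [simp]: "\<rho> $ 0 = 1"
begin

definition w where "w = 2 * \<rho>^2"
definition W where "W = fps_X * w"
definition \<gamma> where "\<gamma> = quadratic_series (fps_const (1/2)) (fps_const (1/2) * W^2)"
definition u where "u = fps_X * \<gamma>"
definition P where "P = 2 - fps_const (W^2) * u"
definition p where "p = 1 - fps_const (W^2) * u"

lemma w_0 [simp]: "w $ 0 = 2" by (simp add: w_def fps_power_zeroth)
lemma W_0 [simp]: "W $ 0 = 0" by (simp add: W_def)

lemma w_eq: "w = 2 + W^3"
  using rho unfolding w_def W_def by algebra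

lemma gamma_eq: "2 * \<gamma> = 1 + fps_const (W^2) * (fps_X * \<gamma>^2)"
proof -
  define h where "h = fps_const (fps_const (1/2 :: rat))"
  have h: "2 * h = 1" unfolding h_def by (simp add: numeral_fps_const)
  have "\<gamma> = h + h * fps_const (W^2) * (fps_X * \<gamma>^2)"
    using quadratic_series[of "fps_const (1/2)" "fps_const (1/2) * W^2"]
    unfolding \<gamma>_def[symmetric] h_def by simp
  then show ?thesis using h by algebra
qed

lemma gamma_0 [simp]: "\<gamma> $ 0 = fps_const (1/2)"
  by (simp add: \<gamma>_def)

lemma gamma_P: "\<gamma> * P = 1"
  using gamma_eq unfolding P_def u_def by algebra

lemma x_eq: "fps_X = u * P"
  using gamma_P unfolding u_def by (simp add: mult.assoc)

lemma P_0 [simp]: "P $ 0 = 2" "p $ 0 = 1"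
  by (simp_all add: P_def p_def u_def)

definition "denom = 1 + lift_x p * lift_y p - xx * yy * lift_t W"

lemma denom_0: "denom $ 0 $ 0 $ 0 = 2"
  by (simp add: denom_def ser3_nth_0)

lemma cancels_denom: "cancels denom"
  by (intro cancels_unit ser3_unitI) (simp add: denom_0)

lemma lifted_relations:
  "lift_t w = 2 + lift_t W ^ 3" "lift_t W = tt * lift_t w"
  "xx = lift_x u * lift_x P" "yy = lift_y u * lift_y P"
  "lift_x P = 2 - lift_t W ^ 2 * lift_x u" "lift_y P = 2 - lift_t W ^ 2 * lift_y u"
  "lift_x p = 1 - lift_t W ^ 2 * lift_x u" "lift_y p = 1 - lift_t W ^ 2 * lift_y u"
  "lift_x \<gamma> * lift_x P = 1" "lift_y \<gamma> * lift_y P = 1"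
proof -
  show "lift_t w = 2 + lift_t W ^ 3" using arg_cong[OF w_eq, of lift_t] by (simp only: lift_t_hom)
  show "lift_t W = tt * lift_t w" unfolding W_def lift_t_hom lift_x_hom ..
  show "xx = lift_x u * lift_x P" using arg_cong[OF x_eq, of lift_x] by (simp only: lift_x_hom)
  show "yy = lift_y u * lift_y P" using arg_cong[OF x_eq, of lift_y] by (simp only: lift_y_hom)
  show "lift_x P = 2 - lift_t W ^ 2 * lift_x u" "lift_x p = 1 - lift_t W ^ 2 * lift_x u" unfolding P_def p_def lift_x_hom lift_t_hom by simp_all
  show "lift_y P = 2 - lift_t W ^ 2 * lift_y u" "lift_y p = 1 - lift_t W ^ 2 * lift_y u" unfolding P_def p_def lift_y_hom lift_t_hom by simp_all
  show "lift_x \<gamma> * lift_x P = 1" using arg_cong[OF gamma_P, of lift_x] by (simp only: lift_x_hom)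
  show "lift_y \<gamma> * lift_y P = 1" using arg_cong[OF gamma_P, of lift_y] by (simp only: lift_y_hom)
qed

lemma lifted_x_eq: "xx = lift_x u * (2 - lift_t W ^ 2 * lift_x u)" "yy = lift_y u * (2 - lift_t W ^ 2 * lift_y u)"
  using lifted_relations by simp_all

lemma denom_eq: "denom = 1 + lift_x p * lift_y p - xx * yy * lift_t W"
  by (simp add: denom_def)

lemma scaled_kernel: "lift_t w * kernel = lift_t w * xx * yy - lift_t W * (xx + yy + xx^2*yy^2)"
  unfolding lifted_relations(2) kernel_def by algebra

lemma kernel_factor: "denom * (yy*(xx-lift_t W)*lift_x p + xx*(yy-lift_t W)*lift_y p) = lift_t w * kernel * (lift_x p + lift_y p)"
  by (rule kernel_factor_id[OF lifted_x_eq lifted_relations(7,8,1) denom_eq scaled_kernel])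

text \<open>The generating function of the Kreweras words.\<close>
lemma kreweras_solution: "\<exists>K F. boundary_eq 1 K F \<and> 8 * F $ 0 = w * (4 - W^3)"
proof -
  define F where "F = fps_const (fps_const (1/2)) * fps_const w * \<gamma> * (2 - fps_const (W^3) * \<gamma>)"
  have F2: "2 * F = fps_const w * \<gamma> * (2 - fps_const (W^3) * \<gamma>)"
  proof -
    define h where "h = fps_const (fps_const (1/2 :: rat))"
    have h: "2 * h = 1" unfolding h_def by (simp add: numeral_fps_const)
    then show ?thesis unfolding F_def h_def[symmetric] by algebra
  qed
  have Fx: "2 * lift_x F * lift_x P^2 = lift_t w * (2 * lift_x P - lift_t W^3)"
    using arg_cong[OF F2, of lift_x] lifted_relations(9) unfolding lift_x_hom lift_t_hom by algebra
  have Fy: "2 * lift_y F * lift_y P^2 = lift_t w * (2 * lift_y P - lift_t W^3)"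
    using arg_cong[OF F2, of lift_y] lifted_relations(10) unfolding lift_y_hom lift_t_hom by algebra
  define D where "D = 2 * lift_t w * denom * lift_x P^2 * lift_y P^2"
  have "cancels D"
    by (intro cancels_unit ser3_unitI) (simp add: D_def denom_0 ser3_nth_0 fps_power_zeroth)
  moreover have "kernel * (2 * lift_t w^2 * (lift_x P*lift_y P-lift_t W^3)*lift_x P*lift_y P) = D * (xx*yy*1 - tt*xx*lift_x F - tt*yy*lift_y F)"
    using kreweras_kernel_id[OF lifted_relations(3-8,1) denom_eq scaled_kernel] Fx Fy lifted_relations(2) unfolding D_def by algebra
  ultimately obtain K where "boundary_eq 1 K F" using boundary_eqI by blast
  moreover have "8 * F $ 0 = w * (4 - W^3)"
  proof -
    have "2 * F $ 0 = w * fps_const (1/2) * (2 - W^3 * fps_const (1/2))"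
      using arg_cong[OF F2, of "\<lambda>f. f $ 0"] by simp
    moreover have "2 * fps_const (1/2::rat) = 1" by (simp add: numeral_fps_const)
    ultimately show ?thesis by algebra
  qed
  ultimately show ?thesis by blast
qed

end

context kernel_param
begin

lemma p_sq: "p^2 = 1 - fps_const (W^2) * fps_X"
  unfolding x_eq P_def p_def by algebra

text \<open>The source \<open>1 / (1 - txy)\<close> enumerates the words in \<open>A\<close> only.\<close>
lemma diagonal_source_solution: 
  assumes I1: "I1 * (1 - tt*xx*yy) = 1"
  shows "\<exists>K F. boundary_eq I1 K F \<and> 4 * \<rho>^3 * fps_X^3 * F $ 0 = 4 * \<rho>^3 - (2*\<rho>^4 + \<rho>^2 + 1)"
proof -
  define r t where "r = fps_const \<rho>" and "t = (fps_const fps_X :: rat fps fps)"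
  define \<Theta> where "\<Theta> = 2*\<rho>^4 + \<rho>^2 + 1"
  define \<pi> where "\<pi> = p * r"
  have r: "4*r^6*t^3 = r^2 - 1"
    using arg_cong[OF rho, of fps_const] unfolding r_def t_def
    by (simp add: numeral_fps_const flip: fps_const_1_eq_1)
  have W: "fps_const W = 2*r^2*t"
    unfolding W_def w_def r_def t_def by (simp add: numeral_fps_const mult.commute)
  have \<pi>: "\<pi>^2 = r^2 - 4*r^6*t^2*fps_X"
  proof -
    have "p^2 = 1 - (2*r^2*t)^2*fps_X" unfolding p_sq W[symmetric] by simp
    then show ?thesis unfolding \<pi>_def by algebra
  qed
  define N where "N = fps_X*(2*r^6*(2*r^2+3)*t^2*(\<pi>+1)+4*r^6*t*(fps_X-t)) + r^2*((2*r^2+1)*(\<pi>+1)-fps_const \<Theta>)*(\<pi>+1)"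
  have "(1+t*fps_X^2)*(\<pi>+1)^2 dvd 1"
    by (intro fps2_unitI) (simp add: \<pi>_def r_def fps_power_zeroth)
  then obtain c where c: "1 = (1+t*fps_X^2)*(\<pi>+1)^2 * c" by (rule dvdE)
  define F where "F = N * c"
  have "(\<pi> + 1) $ 0 $ 0 = 2" by (simp add: \<pi>_def r_def)
  then have nz: "\<pi> + 1 \<noteq> 0" by (metis fps_zero_nth zero_neq_numeral)
  have Th: "fps_const \<Theta> = 2*r^4 + r^2 + 1"
    unfolding \<Theta>_def r_def by (simp add: numeral_fps_const flip: fps_const_1_eq_1)
  have "F*(1+t*fps_X^2)*(\<pi>+1)^2 = N"
    using c unfolding F_def by algebra
  from diagonal_boundary_id[OF r \<pi> W Th this[unfolded N_def] nz]
  have F: "8*r^6*t^3*((fps_X-t)*(1+t*fps_X^2))*F = 4*r^6*(fps_X-2*t+t^3*fps_X-2*t^2*fps_X^2) - fps_const \<Theta>*(fps_X-fps_const W)*(p*r)"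
    unfolding \<pi>_def .
  define dx dy where "dx = (xx - tt)*(1 + tt*xx^2)" and "dy = (yy - tt)*(1 + tt*yy^2)"
  have rt: "lift_x r = lift_t \<rho>" "lift_x t = tt" "lift_y r = lift_t \<rho>" "lift_y t = tt"
    unfolding r_def t_def lift_x_hom lift_y_hom by simp_all
  have Fx: "8*lift_t \<rho>^6*tt^3*dx*lift_x F = 4*lift_t \<rho>^6*(xx-2*tt+tt^3*xx-2*tt^2*xx^2) - lift_t \<Theta>*(xx-lift_t W)*(lift_x p*lift_t \<rho>)"
    using arg_cong[OF F, of lift_x] unfolding lift_x_hom rt dx_def .
  have Fy: "8*lift_t \<rho>^6*tt^3*dy*lift_y F = 4*lift_t \<rho>^6*(yy-2*tt+tt^3*yy-2*tt^2*yy^2) - lift_t \<Theta>*(yy-lift_t W)*(lift_y p*lift_t \<rho>)"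
    using arg_cong[OF F, of lift_y] unfolding lift_y_hom rt dy_def .
  note id = diagonal_kernel_id[OF kernel_def dx_def dy_def lifted_relations(2) refl kernel_factor refl refl refl Fx Fy I1]
  define D where "D = 16 * lift_t \<rho>^6 * tt^3 * xx * yy * denom * dx * dy * (1 - tt*xx*yy)"
  have c16: "cancels (16 * lift_t \<rho>^6)" 
    by (intro cancels_unit ser3_unitI) (simp add: ser3_nth_0 fps_power_zeroth)
  have "cancels dx" unfolding dx_def
    by (intro cancels_mult cancels_xx_minus_tt cancels_unit one_plus_tt_unit)
  moreover from this have "cancels dy" using cancels_swap[of dx] by (simp add: dx_def dy_def swap_simps)
  moreover have "cancels (1 - tt*xx*yy)" 
    using cancels_unit[OF one_plus_tt_unit(2)[of "xx*yy"]] by (simp add: mult.assoc)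
  ultimately have "cancels D" unfolding D_def
    by (intro cancels_mult[OF _ \<open>cancels (1 - tt*xx*yy)\<close>] cancels_mult[OF _ \<open>cancels dy\<close>] cancels_mult[OF _ \<open>cancels dx\<close>]
       cancels_mult[OF _ cancels_denom] cancels_mult[OF _ cancels_yy] cancels_mult[OF _ cancels_xx] cancels_mult[OF _ cancels_power[OF cancels_tt]] c16)
  from boundary_eqI[OF this id[folded D_def]] obtain K where "boundary_eq I1 K F" by blast
  moreover have "4 * \<rho>^3 * fps_X^3 * F $ 0 = 4 * \<rho>^3 - (2*\<rho>^4 + \<rho>^2 + 1)"
  proof -
    have "8*\<rho>^6*fps_X^3*(- fps_X)*F $ 0 = 4*\<rho>^6*(-2*fps_X) - \<Theta> * (- W) * \<rho>"
      using arg_cong[OF F, of "\<lambda>f. f $ 0"]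
      by (simp add: r_def t_def fps_power_zeroth)
    then have "(2*fps_X*\<rho>^3) * (4 * \<rho>^3 * fps_X^3 * F $ 0) = (2*fps_X*\<rho>^3) * (4 * \<rho>^3 - \<Theta>)"
      unfolding W_def w_def by algebra
    moreover have "\<rho> \<noteq> 0" using rho_0 by (metis fps_zero_nth zero_neq_one)
    then have "2*fps_X*\<rho>^3 \<noteq> 0" by simp
    ultimately show ?thesis unfolding \<Theta>_def by (simp only: mult_cancel_left simp_thms)
  qed
  ultimately show ?thesis by blast
qed

text \<open>
  The source \<open>I2\<close> enumerates the words in \<open>A\<close> and \<open>B\<close> in which every prefix contains at least as many
  \<open>A\<close> as \<open>B\<close>, and \<open>I2'\<close> the corresponding words in \<open>A\<close> and \<open>C\<close>.
\<close>
lemma ballot_sources_solution: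
  assumes d: "d = 1 + fps_const (fps_X^2) * (fps_X * d^2)"
    and I2: "I2 * (1 - tt*xx*yy - tt^2*yy*lift_y d) = 1"
    and I2': "I2' * (1 - tt*xx*yy - tt^2*xx*lift_x d) = 1"
  shows "\<exists>K F. boundary_eq (I2 + I2') K F \<and> 
    128 * F $ 0 = w^2 * (5 * (W^3)^2 - 8 * W^3 + 2 * (W^3 - 4)^2) - 8 * w^3 * (W^3 - 2)"
proof -
  define V where "V = W^3"
  define F where "F = fps_const (fps_const (1/16)) * (fps_const w^2*(fps_const V^2*\<gamma>^2*(2*\<gamma>^2+2*\<gamma>+1)
      - 2*fps_const V*\<gamma>^2*(2*\<gamma>+1)) - fps_const w^3*(2*fps_const V*\<gamma>^2*(2*\<gamma>+1) - 8*\<gamma>^2)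
      + fps_const w^2*(fps_const V - 4)*(fps_const V*\<gamma>^2 - 2*\<gamma>) - fps_X*(8*fps_const w^2*fps_const W^2*\<gamma>^2 - 8*fps_const w*fps_const W^2 - 8*fps_const w^2*fps_const W*fps_X*\<gamma>^2 + 16*fps_const fps_X*fps_X*d^2))"
  define m where "m = fps_const (1/8) * (W^4 - 4*W)"
  have F16: "16 * F = fps_const w^2*(fps_const V^2*\<gamma>^2*(2*\<gamma>^2+2*\<gamma>+1) - 2*fps_const V*\<gamma>^2*(2*\<gamma>+1))
      - fps_const w^3*(2*fps_const V*\<gamma>^2*(2*\<gamma>+1) - 8*\<gamma>^2)
      + fps_const w^2*(fps_const V - 4)*(fps_const V*\<gamma>^2 - 2*\<gamma>) - fps_X*(8*fps_const w^2*fps_const W^2*\<gamma>^2 - 8*fps_const w*fps_const W^2 - 8*fps_const w^2*fps_const W*fps_X*\<gamma>^2 + 16*fps_const fps_X*fps_X*d^2)"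
  proof -
    define h where "h = fps_const (fps_const (1/16 :: rat))"
    have h: "16 * h = 1" unfolding h_def by (simp add: numeral_fps_const)
    then show ?thesis unfolding F_def h_def[symmetric] mult.assoc[symmetric] by simp
  qed
  have m8: "8 * m = W^4 - 4*W"
  proof -
    define h where "h = fps_const (1/8 :: rat)"
    have h: "8 * h = 1" unfolding h_def by (simp add: numeral_fps_const)
    then show ?thesis unfolding m_def h_def[symmetric] mult.assoc[symmetric] by simp
  qed
  have m8': "8 * lift_t m = lift_t W^4 - 4 * lift_t W"
    using arg_cong[OF m8, of lift_t] unfolding lift_t_hom .
  have V: "lift_t V = lift_t W ^ 3" unfolding V_def lift_t_hom ..
  have dx: "lift_x d = 1 + tt^2*xx*lift_x d^2" using arg_cong[OF d, of lift_x] unfolding lift_x_hom lift_t_hom by (simp only: mult.assoc)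
  have dy: "lift_y d = 1 + tt^2*yy*lift_y d^2" using arg_cong[OF d, of lift_y] unfolding lift_y_hom lift_x_hom lift_t_hom by (simp only: mult.assoc)
  note Fx = ballot_boundary_id[OF lifted_relations(1,9,3,5,7) dx lifted_relations(2) V refl m8' refl arg_cong[OF F16, of lift_x, unfolded lift_x_hom]]
  note Fy = ballot_boundary_id[OF lifted_relations(1,10,4,6,8) dy lifted_relations(2) V refl m8' refl arg_cong[OF F16, of lift_y, unfolded lift_y_hom lift_x_hom]]
  define Gx where "Gx = lift_t w^2*xx*(lift_t W*xx^3+lift_t w*xx-lift_t W)-3*lift_t w*lift_t W^2*xx^3-2*lift_t w*lift_t W*(lift_t w*xx-lift_t W)-2*lift_t w*((lift_t W*xx^3+lift_t w*xx-lift_t W)-lift_t m*lift_t W*xx^2)*(xx-lift_t W)*lift_x p"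
  define Gy where "Gy = lift_t w^2*yy*(lift_t W*yy^3+lift_t w*yy-lift_t W)-3*lift_t w*lift_t W^2*yy^3-2*lift_t w*lift_t W*(lift_t w*yy-lift_t W)-2*lift_t w*((lift_t W*yy^3+lift_t w*yy-lift_t W)-lift_t m*lift_t W*yy^2)*(yy-lift_t W)*lift_y p"
  have Gx: "lift_t w * Gx = 2 * lift_t W^3 * xx^3 * (lift_t W * xx * lift_x F + lift_t w * xx^2 * lift_x d)"
  proof -
    have "16 * (lift_t w * Gx) = 16 * (2 * lift_t W^3 * xx^3 * (lift_t W * xx * lift_x F + lift_t w * xx^2 * lift_x d))"
      using Fx unfolding Gx_def by (simp only: mult.assoc)
    then show ?thesis by (simp only: mult_cancel_left) simp
  qed
  have Gy: "lift_t w * Gy = 2 * lift_t W^3 * yy^3 * (lift_t W * yy * lift_y F + lift_t w * yy^2 * lift_y d)"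
  proof -
    have "16 * (lift_t w * Gy) = 16 * (2 * lift_t W^3 * yy^3 * (lift_t W * yy * lift_y F + lift_t w * yy^2 * lift_y d))"
      using Fy unfolding Gy_def by (simp only: mult.assoc)
    then show ?thesis by (simp only: mult_cancel_left) simp
  qed
  obtain Br where Br: "lift_t w*(lift_t w*kernel)*Br+denom*(2*lift_t W^2*xx^3*yy^3*lift_t w*xx*yy*(xx+yy)-yy^3*Gx-xx^3*Gy) = 0"
    using ballot_kernel_id[OF lifted_relations(1) scaled_kernel refl refl Gx_def Gy_def refl kernel_factor] by blast
  have kI: "kernel * I2 = xx*yy - tt*yy*lift_y d - tt*xx*I2"
  proof -
    have "(xx*yy - tt*yy - tt*xx^2*yy^2) = yy*(xx - tt*lift_y d)*(1 - tt*xx*yy - tt^2*yy*lift_y d)"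
      using dy by algebra
    then have "I2 * (xx*yy - tt*yy - tt*xx^2*yy^2) = yy*(xx - tt*lift_y d)"
      using I2 by algebra
    then show ?thesis unfolding kernel_def by algebra
  qed
  have kI': "kernel * I2' = xx*yy - tt*xx*lift_x d - tt*yy*I2'"
  proof -
    have "(xx*yy - tt*xx - tt*xx^2*yy^2) = xx*(yy - tt*lift_x d)*(1 - tt*xx*yy - tt^2*xx*lift_x d)"
      using dx by algebra
    then have "I2' * (xx*yy - tt*xx - tt*xx^2*yy^2) = xx*(yy - tt*lift_x d)"
      using I2' by algebra
    then show ?thesis unfolding kernel_def by algebra
  qed
  define E where "E = xx*yy*(I2+I2') - tt*xx*lift_x F - tt*yy*lift_y F"
  define Q where "Q = - 2*lift_t w*lift_t W^2*xx^3*yy^3*denom*(yy*I2+xx*I2') - lift_t w^2*Br"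
  have "lift_t w * (kernel * Q) = - 2*lift_t w^2*lift_t W^2*xx^3*yy^3*denom*(yy*(kernel*I2)+xx*(kernel*I2')) - lift_t w * (lift_t w*(lift_t w*kernel)*Br)"
    unfolding Q_def by algebra
  also have "\<dots> = - 2*lift_t w^2*lift_t W^2*xx^3*yy^3*denom*(yy*(kernel*I2)+xx*(kernel*I2'))
      + denom*(2*lift_t W^2*xx^3*yy^3*lift_t w^2*xx*yy*(xx+yy)-yy^3*(lift_t w*Gx)-xx^3*(lift_t w*Gy))"
    using Br by algebra
  also have "\<dots> = lift_t w * (2*lift_t W^3*xx^3*yy^3*denom*E)"
    unfolding kI kI' Gx Gy E_def lifted_relations(2) by algebra
  finally have "lift_t w * (kernel * Q) = lift_t w * (2*lift_t W^3*xx^3*yy^3*denom*E)" .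
  moreover have "lift_t w \<noteq> 0" 
  proof
    assume "lift_t w = 0"
    then have "lift_t w $ 0 $ 0 $ 0 = 0" by simp
    then show False by (simp add: ser3_nth_0)
  qed
  ultimately have "kernel * Q = 2*lift_t W^3*xx^3*yy^3*denom*E" by (simp only: mult_cancel_left) simp
  moreover have "cancels (2*lift_t W^3*xx^3*yy^3*denom)"
  proof -
    have "cancels (lift_t w)" by (intro cancels_unit ser3_unitI) (simp add: ser3_nth_0)
    then have "cancels (lift_t W)" unfolding lifted_relations(2) by (intro cancels_mult cancels_tt)
    moreover have "cancels 2" by (intro cancels_unit ser3_unitI) simp
    ultimately show ?thesis by (intro cancels_mult cancels_power cancels_xx cancels_yy cancels_denom)
  qed
  ultimately obtain K where "boundary_eq (I2+I2') K F" using boundary_eqI unfolding E_def by blast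
  moreover have "128 * F $ 0 = w^2 * (5 * V^2 - 8 * V + 2 * (V - 4)^2) - 8 * w^3 * (V - 2)"
  proof -
    define h where "h = fps_const (1/2 :: rat)"
    have h: "2 * h = 1" unfolding h_def by (simp add: numeral_fps_const)
    have "16 * F $ 0 = w^2*(V^2*h^2*(2*h^2+2*h+1) - 2*V*h^2*(2*h+1)) - w^3*(2*V*h^2*(2*h+1) - 8*h^2)
      + w^2*(V - 4)*(V*h^2 - 2*h)"
      using arg_cong[OF F16, of "\<lambda>f. f $ 0"]
      by (simp add: fps_power_zeroth gamma_0[folded h_def] del: gamma_0)
    then show ?thesis using h by algebra
  qed
  ultimately show ?thesis unfolding V_def by blast
qed

end

section \<open>Solutions of the functional equation as counting functions\<close>

text \<open>
  For \<open>i = a - b\<close>, \<open>j = a - c\<close>, \<open>m = a + b + c\<close> one has \<open>m + j - 2i = 3b\<close> and \<open>m + i - 2j = 3c\<close>: the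
  coefficients excluded here belong to negative \<open>b\<close> or \<open>c\<close>.
\<close>
lemma boundary_eq_support:
  assumes "boundary_eq I K F"
    and supp: "\<And>i j m. 2 * i > m + j \<or> 2 * j > m + i \<Longrightarrow> I $ j $ i $ m = 0"
    and "2 * i > m + j \<or> 2 * j > m + i"
  shows "K $ j $ i $ m = 0"
  using assms(3)
proof (induction m arbitrary: i j)
  case 0
  then show ?case using boundary_eq_nth[OF assms(1), of j i 0] supp[OF 0] by simp
next
  case (Suc m)
  have "K $ j $ Suc i $ m = 0" "K $ Suc j $ i $ m = 0" 
    using Suc.prems by (auto intro!: Suc.IH)
  moreover have "K $ (j - 1) $ (i - 1) $ m = 0" if "i \<noteq> 0" "j \<noteq> 0"
    using Suc.prems that by (auto intro!: Suc.IH)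
  ultimately show ?case 
    using boundary_eq_nth[OF assms(1), of j i "Suc m"] supp[OF Suc.prems] by simp
qed

lemma boundary_eq_coeff:
  fixes N :: "nat \<Rightarrow> nat \<Rightarrow> nat \<Rightarrow> rat"
  assumes K: "boundary_eq I K F"
    and supp: "\<And>i j m. 2 * i > m + j \<or> 2 * j > m + i \<Longrightarrow> I $ j $ i $ m = 0"
    and rec: "\<And>a b c. b \<le> a \<Longrightarrow> c \<le> a \<Longrightarrow> N a b c = I $ (a - c) $ (a - b) $ (a + b + c)
      + (if b < a \<and> c < a then N (a - 1) b c else 0) + (if 0 < b then N a (b - 1) c else 0)
      + (if 0 < c then N a b (c - 1) else 0)"
    and "b \<le> a" "c \<le> a"
  shows "K $ (a - c) $ (a - b) $ (a + b + c) = N a b c"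
  using assms(4,5)
proof (induction "a + b + c" arbitrary: a b c)
  case 0
  then show ?case using boundary_eq_nth[OF K, of 0 0 0] rec[of 0 0 0] by simp
next
  case (Suc m)
  note le = Suc.prems
  have m: "a + b + c = Suc m" using Suc.hyps(2) by simp
  have A: "(if a - b = 0 \<or> a - c = 0 then 0 else K $ (a - c - 1) $ (a - b - 1) $ m) = (if b < a \<and> c < a then N (a - 1) b c else 0)"
  proof (cases "b < a \<and> c < a")
    case True
    then have "K $ (a - 1 - c) $ (a - 1 - b) $ (a - 1 + b + c) = N (a - 1) b c"
      using m by (intro Suc.hyps(1)) auto
    moreover have "a - 1 + b + c = m" using True m by simp
    ultimately show ?thesis using True by (simp add: diff_commute)
  qed (use le in auto)
  have B: "K $ (a - c) $ Suc (a - b) $ m = (if 0 < b then N a (b - 1) c else 0)"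
  proof (cases "0 < b")
    case True
    then have "K $ (a - c) $ (a - (b - 1)) $ (a + (b - 1) + c) = N a (b - 1) c"
      using m le by (intro Suc.hyps(1)) auto
    moreover have "a + (b - 1) + c = m" "a - (b - 1) = Suc (a - b)" using True m le by simp_all
    ultimately show ?thesis using True by simp
  next
    case False
    then show ?thesis using m le by (auto intro!: boundary_eq_support[OF K supp])
  qed
  have C: "K $ Suc (a - c) $ (a - b) $ m = (if 0 < c then N a b (c - 1) else 0)"
  proof (cases "0 < c")
    case True
    then have "K $ (a - (c - 1)) $ (a - b) $ (a + b + (c - 1)) = N a b (c - 1)"
      using m le by (intro Suc.hyps(1)) auto
    moreover have "a + b + (c - 1) = m" "a - (c - 1) = Suc (a - c)" using True m le by simp_all
    ultimately show ?thesis using True by simp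
  next
    case False
    then show ?thesis using m le by (auto intro!: boundary_eq_support[OF K supp])
  qed
  show ?case
    unfolding rec[OF le] m boundary_eq_nth[OF K, of "a - c" "a - b" "Suc m"] diff_Suc_1 A B C by simp
qed

definition word_count :: "nat \<Rightarrow> nat \<Rightarrow> nat \<Rightarrow> rat" where
  "word_count a b c = of_nat (syt a b c False)"

lemma word_count_rec:
  assumes "b \<le> a" "c \<le> a"
  shows "word_count a b c = (if a = 0 then 1 else 0)
      + (if b < a \<and> c < a then word_count (a - 1) b c else 0) + (if 0 < b then word_count a (b - 1) c else 0)
      + (if 0 < c then word_count a b (c - 1) else 0)"
proof (cases "a = 0")
  case True
  then show ?thesis using assms by (simp add: word_count_def syt_0)
next
  case False
  then show ?thesis using syt_rec[OF assms, of False] by (simp add: word_count_def)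
qed

lemma fps3_1_nth: "(1 :: ser3) $ j $ i $ m = (if j = 0 \<and> i = 0 \<and> m = 0 then 1 else 0)"
  by (auto simp: fps_one_nth)

lemma word_count_eq:
  assumes "boundary_eq 1 K F"
  shows "word_count n n n = F $ 0 $ (3 * n)"
proof -
  have "K $ (n - n) $ (n - n) $ (n + n + n) = word_count n n n"
  proof (rule boundary_eq_coeff[where N = word_count, OF assms])
    fix a b c :: nat assume le: "b \<le> a" "c \<le> a"
    have "(1 :: ser3) $ (a - c) $ (a - b) $ (a + b + c) = (if a = 0 then 1 else 0)"
      using le by (auto simp: fps3_1_nth)
    then show "word_count a b c = (1 :: ser3) $ (a - c) $ (a - b) $ (a + b + c) + (if b < a \<and> c < a then word_count (a - 1) b c else 0)
      + (if 0 < b then word_count a (b - 1) c else 0) + (if 0 < c then word_count a b (c - 1) else 0)"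
      by (simp only: word_count_rec[OF le])
  qed (auto simp: fps3_1_nth)
  moreover have "n + n + n = 3 * n" by simp
  ultimately show ?thesis using boundary_eq_boundary[OF assms] by (simp only: diff_self_eq_0)
qed

text \<open>
  \<open>late_count\<close> counts the words with \<open>D\<close> inserted after the first \<open>B\<close> and the first \<open>C\<close>,
  \<open>early_count\<close> the remaining insertions of an additional letter \<open>D\<close> into a Kreweras word.
\<close>
definition late_count :: "nat \<Rightarrow> nat \<Rightarrow> nat \<Rightarrow> rat" where
  "late_count a b c = (if 0 < b \<and> 0 < c then of_nat (syt a b c True) else 0)"

definition early_count :: "nat \<Rightarrow> nat \<Rightarrow> nat \<Rightarrow> rat" where
  "early_count a b c = of_nat (a + b + c + 1) * word_count a b c - late_count a b c"

lemma late_count_rec: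
  assumes "b \<le> a" "c \<le> a"
  shows "late_count a b c = (if 0 < b \<and> 0 < c then word_count a b c else 0) +
      (if b < a \<and> c < a then late_count (a - 1) b c else 0) + (if 0 < b then late_count a (b - 1) c else 0)
      + (if 0 < c then late_count a b (c - 1) else 0)"
proof (cases "0 < b \<and> 0 < c")
  case True
  then show ?thesis using syt_rec[OF assms, of True] assms by (auto simp: late_count_def word_count_def)
next
  case False
  then show ?thesis by (auto simp: late_count_def)
qed

text \<open>The early insertions have as their source the words in which \<open>B\<close> or \<open>C\<close> is missing.\<close>
lemma early_count_rec:
  assumes "b \<le> a" "c \<le> a"
  shows "early_count a b c = (if 0 < b \<and> 0 < c then 0 else word_count a b c) +
      (if b < a \<and> c < a then early_count (a - 1) b c else 0) + (if 0 < b then early_count a (b - 1) c else 0)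
      + (if 0 < c then early_count a b (c - 1) else 0)"
proof (cases "a = 0")
  case True
  then show ?thesis using assms by (simp add: early_count_def late_count_def word_count_def syt_0)
next
  case False
  define s where "s = (of_nat (a + b + c) :: rat)"
  define A where "A = (if b < a \<and> c < a then word_count (a - 1) b c else 0)"
  define B where "B = (if 0 < b then word_count a (b - 1) c else 0)"
  define C where "C = (if 0 < c then word_count a b (c - 1) else 0)"
  have w: "word_count a b c = A + B + C"
    using word_count_rec[OF assms] False by (simp add: A_def B_def C_def)
  have 1: "(if b < a \<and> c < a then early_count (a - 1) b c else 0) = s * A - (if b < a \<and> c < a then late_count (a - 1) b c else 0)"
    using False by (simp add: early_count_def A_def s_def)
  have 2: "(if 0 < b then early_count a (b - 1) c else 0) = s * B - (if 0 < b then late_count a (b - 1) c else 0)"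
    by (simp add: early_count_def B_def s_def)
  have 3: "(if 0 < c then early_count a b (c - 1) else 0) = s * C - (if 0 < c then late_count a b (c - 1) else 0)"
    by (simp add: early_count_def C_def s_def)
  have "early_count a b c = (s + 1) * (A + B + C) - late_count a b c"
    unfolding early_count_def w[symmetric] by (simp add: s_def)
  then show ?thesis
    unfolding 1 2 3 late_count_rec[OF assms] w by (auto simp: algebra_simps)
qed

text \<open>
  The coefficients of the series from which the source is formed: words in \<open>A\<close> only here, words in \<open>A\<close> and
  \<open>B\<close> next; \<open>swap\<close> turns the latter into words in \<open>A\<close> and \<open>C\<close>.
\<close>
lemma diag_source_nth:
  assumes "I1 * (1 - tt*xx*yy) = 1"
  shows "I1 $ j $ i $ m = (if i = j \<and> j = m then 1 else 0)"
proof -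
  have I1: "I1 = 1 + tt * (xx * (yy * I1))" using assms by algebra
  show ?thesis
  proof (induction m arbitrary: i j)
    case 0
    show ?case by (subst I1) (auto simp: fps3_1_nth)
  next
    case (Suc m)
    show ?case by (subst I1) (cases i; cases j; simp add: fps3_1_nth Suc.IH)
  qed
qed

lemma ballot_source_nth:
  assumes I2: "I2 * (1 - tt*xx*yy - tt^2*yy*lift_y d) = 1" and dy: "lift_y d = 1 + tt^2*yy*lift_y d^2"
  shows "I2 $ j $ i $ m = (if m + i = 2 * j \<and> i \<le> j then word_count j (j - i) 0 else 0)"
proof -
  \<comment> \<open>The Catalan series \<open>d\<close> splits off the root \<open>x = t d\<close> of the kernel of walks with steps \<open>A\<close> and \<open>B\<close>.\<close>
  have "(xx - tt - tt*xx^2*yy) = (xx - tt*lift_y d)*(1 - tt*xx*yy - tt^2*yy*lift_y d)"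
    using dy by algebra
  then have "I2 * (xx - tt - tt*xx^2*yy) = xx - tt*lift_y d"
    using I2 by algebra
  then have e: "xx * I2 = xx + tt * I2 + tt * (xx * (xx * (yy * I2))) - tt * lift_y d"
    by algebra
  have rec: "I2 $ j $ i $ m = (if j = 0 \<and> i = 0 \<and> m = 0 then 1 else 0) + (if m = 0 then 0 else I2 $ j $ Suc i $ (m - 1)
     + (if i = 0 \<or> j = 0 then 0 else I2 $ (j - 1) $ (i - 1) $ (m - 1)))" for i j m
  proof -
    have lift_y: "lift_y d $ j $ Suc i = 0" by (simp add: lift_y_def lift_x_def)
    have xx: "xx $ j $ Suc i $ m = (if j = 0 \<and> i = 0 \<and> m = 0 then 1 else 0)" by (auto simp: fps_X_def)
    have "(xx * I2) $ j $ Suc i $ m = (xx + tt * I2 + tt * (xx * (xx * (yy * I2))) - tt * lift_y d) $ j $ Suc i $ m"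
      using e by simp
    then have "I2 $ j $ i $ m = xx $ j $ Suc i $ m + (fps_X * I2 $ j $ Suc i) $ m
        + (if i = 0 \<or> j = 0 then 0 else (fps_X * I2 $ (j - 1) $ (i - 1)) $ m)"
      unfolding fps_add_nth fps_sub_nth var_mult_nth lift_y by (cases i) auto
    then show ?thesis unfolding xx by (cases m) auto
  qed
  show ?thesis
  proof (induction m arbitrary: i j)
    case 0
    show ?case by (subst rec) (auto simp: word_count_def syt_0)
  next
    case (Suc m)
    show ?case
    proof (cases "Suc m + i = 2 * j \<and> i \<le> j")
      case True
      then have j: "j > 0" by simp
      have "word_count j (j - i) 0 = (if 0 < i then word_count (j - 1) (j - i) 0 else 0) + (if i < j then word_count j (j - i - 1) 0 else 0)"
        using word_count_rec[of "j - i" j 0] j True by (cases i) auto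
      moreover have "I2 $ j $ Suc i $ m = (if i < j then word_count j (j - i - 1) 0 else 0)"
        unfolding Suc.IH using True by auto
      moreover have "(if i = 0 \<or> j = 0 then 0 else I2 $ (j - 1) $ (i - 1) $ m) = (if 0 < i then word_count (j - 1) (j - i) 0 else 0)"
        unfolding Suc.IH using True j by auto
      ultimately show ?thesis
        unfolding rec[of j i "Suc m"] diff_Suc_1 by (simp only: True simp_thms if_True nat.distinct if_False add_0_left)
    next
      case False
      then have "I2 $ j $ Suc i $ m = 0" "(if i = 0 \<or> j = 0 then 0 else I2 $ (j - 1) $ (i - 1) $ m) = 0"
        unfolding Suc.IH by auto
      then show ?thesis
        unfolding rec[of j i "Suc m"] diff_Suc_1 by (simp only: False nat.distinct simp_thms if_False add_0_left)
    qed
  qed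
qed

lemma word_count_swap: "b \<le> a \<Longrightarrow> c \<le> a \<Longrightarrow> word_count a b c = word_count a c b"
proof (induction "a + b + c" arbitrary: a b c rule: less_induct)
  case less
  have "(if b < a \<and> c < a then word_count (a - 1) b c else 0) = (if c < a \<and> b < a then word_count (a - 1) c b else 0)"
     "(if 0 < b then word_count a (b - 1) c else 0) = (if 0 < b then word_count a c (b - 1) else 0)"
     "(if 0 < c then word_count a b (c - 1) else 0) = (if 0 < c then word_count a (c - 1) b else 0)"
    using less.prems by (auto intro!: less.hyps)
  then show ?case unfolding word_count_rec[OF less.prems] word_count_rec[OF less.prems(2,1)] by simp
qed

lemma word_count_diag: "word_count a 0 0 = 1"
proof (induction a)
  case (Suc a)
  then show ?case using word_count_rec[of 0 "Suc a" 0] by simp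
qed (simp add: word_count_def syt_0)

text \<open>Words with \<open>B\<close> or \<open>C\<close> missing are enumerated by inclusion and exclusion.\<close>
lemma early_count_eq:
  assumes I1: "I1 * (1 - tt*xx*yy) = 1"
    and I2: "I2 * (1 - tt*xx*yy - tt^2*yy*lift_y d) = 1" and dy: "lift_y d = 1 + tt^2*yy*lift_y d^2"
    and K: "boundary_eq (I2 + swap I2 - I1) K F"
  shows "early_count n n n = F $ 0 $ (3 * n)"
proof -
  note nth = diag_source_nth[OF I1] ballot_source_nth[OF I2 dy]
  have "K $ (n - n) $ (n - n) $ (n + n + n) = early_count n n n"
  proof (rule boundary_eq_coeff[where N = early_count, OF K])
    fix a b c :: nat assume le: "b \<le> a" "c \<le> a"
    have "(I2 + swap I2 - I1) $ (a - c) $ (a - b) $ (a + b + c) = (if 0 < b \<and> 0 < c then 0 else word_count a b c)"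
    proof -
      have "I2 $ (a - c) $ (a - b) $ (a + b + c) = (if c = 0 then word_count a b 0 else 0)"
        unfolding nth using le by auto
      moreover have "swap I2 $ (a - c) $ (a - b) $ (a + b + c) = (if b = 0 then word_count a 0 c else 0)"
        unfolding swap_nth nth using le word_count_swap[of c a 0] by auto
      moreover have "I1 $ (a - c) $ (a - b) $ (a + b + c) = (if b = 0 \<and> c = 0 then 1 else 0)"
        unfolding nth using le by auto
      ultimately show ?thesis by (auto simp: word_count_diag)
    qed
    then show "early_count a b c = (I2 + swap I2 - I1) $ (a - c) $ (a - b) $ (a + b + c) +
      (if b < a \<and> c < a then early_count (a - 1) b c else 0) + (if 0 < b then early_count a (b - 1) c else 0)
      + (if 0 < c then early_count a b (c - 1) else 0)"
      using early_count_rec[OF le] by simp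
  next
    fix i j m :: nat assume "2 * i > m + j \<or> 2 * j > m + i"
    then show "(I2 + swap I2 - I1) $ j $ i $ m = 0" by (auto simp: nth)
  qed simp_all
  moreover have "n + n + n = 3 * n" by simp
  ultimately show ?thesis using boundary_eq_boundary[OF K] by (simp only: diff_self_eq_0)
qed

section \<open>Coefficients of the powers of the ternary tree series\<close>
definition poly_fun :: "(rat \<Rightarrow> rat) \<Rightarrow> bool" where
  "poly_fun f \<longleftrightarrow> (\<exists>p. \<forall>x. f x = poly p x)"

lemma poly_fun_eqI:
  assumes "poly_fun f" "poly_fun g" "\<And>n::nat. f (of_nat n) = g (of_nat n)"
  shows "f = g"
proof -
  obtain p q where pq: "\<And>x. f x = poly p x" "\<And>x. g x = poly q x"
    using assms(1,2) unfolding poly_fun_def by blast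
  have "p - q = 0"
  proof (rule ccontr)
    assume "p - q \<noteq> 0"
    then have "finite {x. poly (p - q) x = 0}" by (rule poly_roots_finite)
    moreover have "range (of_nat :: nat \<Rightarrow> rat) \<subseteq> {x. poly (p - q) x = 0}"
      using assms(3) pq by auto
    ultimately have "finite (range (of_nat :: nat \<Rightarrow> rat))" by (rule finite_subset[rotated])
    then show False by (simp add: finite_image_iff inj_on_def)
  qed
  then show ?thesis using pq by (intro ext) simp
qed

lemma poly_fun_const: "poly_fun (\<lambda>x. c)"
  unfolding poly_fun_def by (rule exI[of _ "[:c:]"]) simp

lemma poly_fun_add: "poly_fun f \<Longrightarrow> poly_fun g \<Longrightarrow> poly_fun (\<lambda>x. f x + g x)"
  unfolding poly_fun_def by (metis poly_add)

lemma poly_fun_diff: "poly_fun f \<Longrightarrow> poly_fun g \<Longrightarrow> poly_fun (\<lambda>x. f x - g x)"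
  unfolding poly_fun_def by (metis poly_diff)

lemma poly_fun_mult: "poly_fun f \<Longrightarrow> poly_fun g \<Longrightarrow> poly_fun (\<lambda>x. f x * g x)"
  unfolding poly_fun_def by (metis poly_mult)

lemma poly_fun_sum: "(\<And>i. poly_fun (f i)) \<Longrightarrow> poly_fun (\<lambda>x. \<Sum>i\<in>A. f i x)"
  by (induction A rule: infinite_finite_induct) (simp_all add: poly_fun_const poly_fun_add)

lemma poly_fun_id: "poly_fun (\<lambda>x. x)"
  unfolding poly_fun_def by (rule exI[of _ "[:0, 1:]"]) simp

lemma poly_fun_gbinomial: "poly_fun (\<lambda>x. (x + c) gchoose k)"
proof (induction k)
  case (Suc k)
  have "(\<lambda>x. (x + c) gchoose Suc k) = (\<lambda>x. ((x + c) gchoose k) * ((x + (c - of_nat k)) * (1 / of_nat (Suc k))))"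
    using gbinomial_mult_1[of "x + c" k for x] by (intro ext) (simp add: field_simps)
  moreover have "poly_fun \<dots>"
    by (intro poly_fun_mult Suc poly_fun_add poly_fun_id poly_fun_const)
  ultimately show ?case by simp
qed (simp add: poly_fun_const)

text \<open>
  \<open>1 + ternary\<close> is the solution \<open>B\<close> of \<open>B = 1 + X B\<^sup>3\<close>, and \<open>ternary_pow r\<close> is its power \<open>B\<^sup>r\<close> for rational
  \<open>r\<close>, obtained by substitution into the binomial series.
\<close>
definition ternary :: "rat fps" where "ternary = fps_inv (fps_X * fps_binomial (- 3))"

definition ternary_pow :: "rat \<Rightarrow> rat fps" where "ternary_pow r = fps_binomial r oo ternary"

lemma ternary_0 [simp]: "ternary $ 0 = 0"
  by (simp add: ternary_def fps_inv_def)

lemma ternary_pow_add: "ternary_pow (r + s) = ternary_pow r * ternary_pow s"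
  by (simp add: ternary_pow_def fps_binomial_add_mult fps_compose_mult_distrib)

lemma ternary_pow_0 [simp]: "ternary_pow 0 = 1"
  by (simp add: ternary_pow_def)

lemma ternary_pow_nth_0 [simp]: "ternary_pow r $ 0 = 1"
  by (simp add: ternary_pow_def)

lemma ternary_eq: "ternary = fps_X * ternary_pow 3"
proof -
  have "(fps_X * fps_binomial (- 3)) oo ternary = (fps_X :: rat fps)"
    unfolding ternary_def by (intro fps_inv_right) simp_all
  then have "ternary * ternary_pow (- 3) = fps_X"
    by (simp add: fps_compose_mult_distrib ternary_pow_def)
  moreover have "ternary_pow (- 3) * ternary_pow 3 = 1"
    by (simp flip: ternary_pow_add)
  ultimately show ?thesis by (metis mult.assoc mult.right_neutral)
qed

lemma ternary_pow_1: "ternary_pow 1 = 1 + fps_X * ternary_pow 3"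
  unfolding ternary_eq [symmetric] by (simp add: ternary_pow_def fps_binomial_1 fps_compose_add_distrib)

lemma ternary_pow_nth_Suc: "ternary_pow (r + 1) $ Suc n = ternary_pow r $ Suc n + ternary_pow (r + 3) $ n"
proof -
  have "ternary_pow (r + 1) = ternary_pow r + fps_X * ternary_pow (r + 3)"
    by (simp add: ternary_pow_add ternary_pow_1 algebra_simps)
  then show ?thesis by simp
qed

lemma poly_fun_ternary_pow: "poly_fun (\<lambda>r. ternary_pow r $ n)"
  unfolding ternary_pow_def fps_compose_nth fps_binomial_nth
  by (intro poly_fun_sum poly_fun_mult poly_fun_const) (use poly_fun_gbinomial[of 0] in simp)

text \<open>
  For \<open>n > 0\<close> this equals \<open>(r/n)\<close> times the binomial coefficient of \<open>3n + r - 1\<close> over \<open>n - 1\<close>; the difference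
  of two binomial coefficients makes the recurrence in \<open>r\<close> an instance of Pascal's rule.
\<close>
definition ternary_coeff :: "nat \<Rightarrow> rat \<Rightarrow> rat" where
  "ternary_coeff n r = (if n = 0 then 1 else
     ((r + of_nat (3 * n - 1)) gchoose n) - 2 * ((r + of_nat (3 * n - 1)) gchoose (n - 1)))"

lemma ternary_coeff_Suc: 
  "ternary_coeff (Suc n) r = ((r + of_nat (3 * n + 2)) gchoose Suc n) - 2 * ((r + of_nat (3 * n + 2)) gchoose n)"
  by (simp add: ternary_coeff_def)

lemma ternary_coeff_step: "ternary_coeff (Suc n) (r + 1) = ternary_coeff (Suc n) r + ternary_coeff n (r + 3)"
proof (cases n)
  case 0
  then show ?thesis by (simp add: ternary_coeff_def)
next
  case (Suc m)
  define M where "M = r + of_nat (3 * n + 2)"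
  have M: "r + 1 + of_nat (3 * n + 2) = M + 1" "r + 3 + of_nat (3 * m + 2) = M"
    by (simp_all add: M_def Suc)
  show ?thesis
    unfolding ternary_coeff_Suc M M_def[symmetric] unfolding Suc unfolding ternary_coeff_Suc M gbinomial_Suc_Suc by simp
qed

lemma ternary_coeff_0_right: "ternary_coeff (Suc n) 0 = 0"
proof -
  have "of_nat (Suc n) * ((of_nat (3*n+2) :: rat) gchoose Suc n) = (of_nat (3*n+2) - of_nat n) * (of_nat (3*n+2) gchoose n)"
    using gbinomial_mult_1[of "of_nat (3*n+2) :: rat" n] by (simp add: algebra_simps)
  also have "(of_nat (3*n+2) - of_nat n :: rat) = of_nat (Suc n) * 2" by simp
  finally show ?thesis unfolding ternary_coeff_Suc by (simp add: mult.assoc del: of_nat_Suc)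
qed

text \<open>
  Both sides are polynomial in \<open>r\<close> and vanish at \<open>r = 0\<close> when \<open>n > 0\<close>. By \<open>B\<^sup>r\<^sup>+\<^sup>1 = B\<^sup>r + X B\<^sup>r\<^sup>+\<^sup>3\<close>
  their increments from \<open>r\<close> to \<open>r + 1\<close> agree, hence they agree for all natural \<open>r\<close>, and then for all \<open>r\<close>.
\<close>
theorem ternary_pow_nth: "ternary_pow r $ n = ternary_coeff n r"
proof (induction n arbitrary: r)
  case 0
  show ?case by (simp add: ternary_coeff_def)
next
  case (Suc n)
  have "(\<lambda>r. ternary_pow r $ Suc n) = ternary_coeff (Suc n)"
  proof (rule poly_fun_eqI)
    show "poly_fun (ternary_coeff (Suc n))"
      unfolding ternary_coeff_def by (simp add: poly_fun_diff poly_fun_mult poly_fun_const poly_fun_gbinomial del: of_nat_mult of_nat_Suc of_nat_add)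
    show "ternary_pow (of_nat m) $ Suc n = ternary_coeff (Suc n) (of_nat m)" for m
    proof (induction m)
      case 0
      show ?case by (simp add: ternary_coeff_0_right)
    next
      case (Suc m)
      have "ternary_pow (of_nat m + 1) $ Suc n = ternary_coeff (Suc n) (of_nat m + 1)"
        unfolding ternary_pow_nth_Suc ternary_coeff_step Suc \<open>\<And>r. ternary_pow r $ n = ternary_coeff n r\<close> ..
      then show ?case by (simp add: add.commute)
    qed
  qed (rule poly_fun_ternary_pow)
  then show ?case by (rule fun_cong)
qed

text \<open>The powers \<open>b\<^sup>r\<close> of the solution of \<open>b = 1 + 4 t\<^sup>3 b\<^sup>3\<close>.\<close>
definition tpow :: "rat \<Rightarrow> rat fps" where
  "tpow r = ternary_pow r oo (fps_const 4 * fps_X ^ 3)"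

lemma tpow_add: "tpow (r + s) = tpow r * tpow s"
  by (simp add: tpow_def ternary_pow_add fps_compose_mult_distrib fps_power_zeroth)

lemma tpow_0 [simp]: "tpow 0 = 1"
  by (simp add: tpow_def)

lemma tpow_power: "tpow r ^ n = tpow (of_nat n * r)"
  by (induction n) (simp_all add: tpow_add [symmetric] ring_distribs)

lemma tpow_nth_0 [simp]: "tpow r $ 0 = 1"
  by (simp add: tpow_def)

lemma tpow_1: "tpow 1 = 1 + 4 * fps_X^3 * tpow 3"
  unfolding tpow_def ternary_pow_1
  by (simp add: fps_compose_mult_distrib fps_compose_add_distrib fps_power_zeroth numeral_fps_const)

lemma tpow_nth: "tpow r $ (3 * n) = 4 ^ n * ternary_coeff n r"
proof -
  have "(fps_const 4 * fps_X ^ 3 :: rat fps) ^ i $ (3 * n) = (if i = n then 4 ^ n else 0)" for i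
    by (simp add: power_mult_distrib fps_const_power flip: power_mult)
  then have "tpow r $ (3 * n) = (\<Sum>i=0..3*n. if i = n then 4 ^ n * ternary_coeff n r else 0)"
    unfolding tpow_def fps_compose_nth ternary_pow_nth by (intro sum.cong) auto
  then show ?thesis by simp
qed

lemma ternary_coeff_fact:
  assumes "r \<ge> 1"
  shows "ternary_coeff n (of_nat r) = of_nat r * fact (3 * n + r - 1) / (fact n * fact (2 * n + r))"
proof (cases n)
  case 0
  then show ?thesis using assms by (simp add: ternary_coeff_def fact_reduce)
next
  case (Suc m)
  define N where "N = 3 * n + r - 1"
  have N: "of_nat r + of_nat (3 * n - 1) = (of_nat N :: rat)"
    unfolding N_def of_nat_add[symmetric] using Suc by (intro arg_cong[where f = of_nat]) simp
  have 1: "(of_nat N gchoose n :: rat) = fact N / (fact n * fact (2 * n + r - 1))"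
  proof -
    have "(of_nat N gchoose n :: rat) = fact N / (fact n * fact (N - n))"
      unfolding binomial_gbinomial[symmetric] by (rule binomial_fact) (use assms in \<open>simp add: N_def\<close>)
    also have "N - n = 2 * n + r - 1" using assms by (simp add: N_def)
    finally show ?thesis .
  qed
  have 2: "(of_nat N gchoose m :: rat) = fact N / (fact m * fact (2 * n + r))"
  proof -
    have "(of_nat N gchoose m :: rat) = fact N / (fact m * fact (N - m))"
      unfolding binomial_gbinomial[symmetric] by (rule binomial_fact) (use assms Suc in \<open>simp add: N_def\<close>)
    also have "N - m = 2 * n + r" using assms Suc by (simp add: N_def)
    finally show ?thesis .
  qed
  have 3: "fact (2 * n + r) = (of_nat (2 * n + r) :: rat) * fact (2 * n + r - 1)"
    using assms by (intro fact_reduce) simp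
  have arith: "F / (a * f * g) - 2 * (F / (f * (k * g))) = F / (a * f * (k * g)) * (k - 2 * a)"
    if "a \<noteq> 0" "k \<noteq> 0" for F a f g k :: rat
    using that by (cases "f = 0 \<or> g = 0") (auto simp: field_simps)
  have n: "fact n = (of_nat n * fact m :: rat)" using Suc by simp
  have "ternary_coeff n (of_nat r) = (of_nat N gchoose n) - 2 * (of_nat N gchoose m)"
    unfolding ternary_coeff_def N using Suc by simp
  also have "\<dots> = fact N / (fact n * fact (2 * n + r)) * (of_nat (2 * n + r) - 2 * of_nat n)"
    unfolding 1 2 3 n by (rule arith) (use Suc in simp_all)
  also have "of_nat (2 * n + r) - 2 * of_nat n = (of_nat r :: rat)" by simp
  finally have "ternary_coeff n (of_nat r) = fact N / (fact n * fact (2 * n + r)) * of_nat r" .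
  then show ?thesis by (simp add: N_def)
qed

lemma ternary_coeff_half:
  fixes n :: nat
  defines "h \<equiv> (of_nat (3 * n) + 1/2 :: rat) gchoose n"
  shows "2 * ternary_coeff (Suc n) (1/2) + ternary_coeff (Suc n) (-1/2) + ternary_coeff (Suc n) (-3/2)
    = - 3 * (7 * of_nat n + 5) / ((of_nat n + 1) * (4 * of_nat n + 3) * (4 * of_nat n + 5)) * h"
proof -
  define k :: rat where "k = of_nat n"
  have k: "k \<ge> 0" by (simp add: k_def)
  have r: "ternary_coeff (Suc n) r = r / (k + 1) * ((r + 3 * k + 2) gchoose n)" for r
  proof -
    have "(k + 1) * ((r + 3 * k + 2) gchoose Suc n) = (r + 3 * k + 2 - k) * ((r + 3 * k + 2) gchoose n)"
      using gbinomial_mult_1[of "r + 3 * k + 2" n] by (simp add: k_def algebra_simps)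
    then have "(r + 3 * k + 2) gchoose Suc n = (r + 2 * k + 2) / (k + 1) * ((r + 3 * k + 2) gchoose n)"
      using k by (simp add: field_simps)
    moreover have "r + of_nat (3 * n + 2) = r + 3 * k + 2" by (simp add: k_def)
    ultimately show ?thesis unfolding ternary_coeff_Suc using k by (simp add: field_simps)
  qed
  have up: "(a + 1 gchoose n) = (a + 1) / (a + 1 - k) * (a gchoose n)" if "a + 1 \<noteq> k" for a
    using gbinomial_absorb_comp[of "a + 1" n] that by (simp add: k_def field_simps)
  have h0: "(-3/2 + 3 * k + 2 gchoose n) = h" 
    unfolding h_def k_def by (rule arg_cong2[where f = gbinomial]) simp_all
  have h1: "(-1/2 + 3 * k + 2 gchoose n) = (3 * k + 3/2) / (2 * k + 3/2) * h"
    using up[of "-3/2 + 3 * k + 2"] k unfolding h0 by (simp add: algebra_simps)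
  have h2: "(1/2 + 3 * k + 2 gchoose n) = (3 * k + 5/2) / (2 * k + 5/2) * ((3 * k + 3/2) / (2 * k + 3/2) * h)"
    using up[of "-1/2 + 3 * k + 2"] k unfolding h1 by (simp add: algebra_simps)
  have "2 * (1/2 / (k + 1) * ((3 * k + 5/2) / (2 * k + 5/2) * ((3 * k + 3/2) / (2 * k + 3/2) * h)))
     + (-1/2) / (k + 1) * ((3 * k + 3/2) / (2 * k + 3/2) * h) + (-3/2) / (k + 1) * h
     = - 3 * (7 * k + 5) / ((k + 1) * (4 * k + 3) * (4 * k + 5)) * h"
  proof -
    have "k + 1 \<noteq> 0" "4 * k + 3 \<noteq> 0" "4 * k + 5 \<noteq> 0" using k by linarith+
    moreover have "2 * k + 5/2 = (4 * k + 5) / 2" "2 * k + 3/2 = (4 * k + 3) / 2" by simp_all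
    ultimately show ?thesis by (simp add: divide_simps) (simp add: algebra_simps)
  qed
  then show ?thesis unfolding r h0 h1 h2 unfolding k_def .
qed

lemma gbinomial_half_prod:
  "4 ^ n * ((of_nat (3 * n) + 1/2 :: rat) gchoose n) = (of_nat n + 1) * (4 * of_nat n + 3) * (4 * of_nat n + 5) / 15 *
    (\<Prod>k = 1..n. 6 * (2 * of_nat k - 1) * (6 * of_nat k - 1) * (6 * of_nat k + 1) /
        ((of_nat k + 1) * (4 * of_nat k + 3) * (4 * of_nat k + 5)))"
proof (induction n)
  case (Suc n)
  define k :: rat where "k = of_nat n"
  have k: "k \<ge> 0" by (simp add: k_def)
  define h where "h = ((3 * k + 1/2) gchoose n)"
  define Pr :: rat where "Pr = (\<Prod>k = 1..n. 6 * (2 * of_nat k - 1) * (6 * of_nat k - 1) * (6 * of_nat k + 1) /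
        ((of_nat k + 1) * (4 * of_nat k + 3) * (4 * of_nat k + 5)))"
  have IH: "4 ^ n * h = (k + 1) * (4 * k + 3) * (4 * k + 5) / 15 * Pr"
    using Suc unfolding h_def k_def Pr_def by simp
  have up: "(a + 1 gchoose n) = (a + 1) / (a + 1 - k) * (a gchoose n)" if "a + 1 \<noteq> k" for a
    using gbinomial_absorb_comp[of "a + 1" n] that by (simp add: k_def field_simps)
  have h1: "(3 * k + 3/2 gchoose n) = (3 * k + 3/2) / (2 * k + 3/2) * h"
    using up[of "3 * k + 1/2"] k unfolding h_def by (simp add: algebra_simps)
  have h2: "(3 * k + 5/2 gchoose n) = (3 * k + 5/2) / (2 * k + 5/2) * ((3 * k + 3/2) / (2 * k + 3/2) * h)"
    using up[of "3 * k + 3/2"] k unfolding h1 by (simp add: algebra_simps)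
  have "(of_nat (3 * Suc n) + 1/2 :: rat) gchoose Suc n = ((3 * k + 5/2) + 1) gchoose Suc n"
    by (rule arg_cong2[where f = gbinomial]) (simp_all add: k_def)
  also have "\<dots> = (3 * k + 7/2) / (k + 1) * ((3 * k + 5/2) / (2 * k + 5/2) * ((3 * k + 3/2) / (2 * k + 3/2) * h))"
    unfolding gbinomial_factors h2 by (simp add: k_def ac_simps)
  finally have "4 ^ Suc n * ((of_nat (3 * Suc n) + 1/2 :: rat) gchoose Suc n) = 
     4 * ((3 * k + 7/2) / (k + 1) * ((3 * k + 5/2) / (2 * k + 5/2) * ((3 * k + 3/2) / (2 * k + 3/2)))) * (4 ^ n * h)"
    by simp
  also have "\<dots> = ((k + 1) + 1) * (4 * (k + 1) + 3) * (4 * (k + 1) + 5) / 15 * (Pr *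
     (6 * (2 * (k + 1) - 1) * (6 * (k + 1) - 1) * (6 * (k + 1) + 1) /
        (((k + 1) + 1) * (4 * (k + 1) + 3) * (4 * (k + 1) + 5))))"
  proof -
    have "k + 1 \<noteq> 0" "4 * k + 3 \<noteq> 0" "4 * k + 5 \<noteq> 0" "4 * k + 7 \<noteq> 0" "4 * k + 9 \<noteq> 0" "k + 2 \<noteq> 0" using k by linarith+
    moreover have "2 * k + 5/2 = (4 * k + 5) / 2" "2 * k + 3/2 = (4 * k + 3) / 2" by simp_all
    moreover have "4 * (k + 1) + 3 = 4 * k + 7" "4 * (k + 1) + 5 = 4 * k + 9" "(k + 1) + 1 = k + 2" by simp_all
    ultimately show ?thesis unfolding IH by (simp add: divide_simps) (simp add: algebra_simps)
  qed
  finally show ?case unfolding Pr_def k_def by (simp add: add.commute)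
qed simp

section \<open>The closed form\<close>
lemma kernel_param_tpow: "kernel_param (tpow (1/2))"
proof
  show "4 * tpow (1/2) ^ 6 * fps_X ^ 3 = tpow (1/2) ^ 2 - 1"
    unfolding tpow_power using tpow_1 by (simp add: mult_ac)
qed simp

interpretation tp: kernel_param "tpow (1/2)" by (rule kernel_param_tpow)

lemma w_tpow: "tp.w = 2 * tpow 1"
  unfolding tp.w_def tpow_power by simp

lemma W3_tpow: "tp.W^3 = 2 * tpow 1 - 2"
  using tp.w_eq unfolding w_tpow by algebra

lemma ternary_coeff_values:
  fixes n :: nat
  defines "k \<equiv> of_nat n :: rat" and "a \<equiv> fact (3 * n) / (fact n * fact (2 * n + 1)) :: rat"
  shows "ternary_coeff n 1 = a"
    "ternary_coeff n 2 = 2 * (3 * k + 1) / (2 * k + 2) * a"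
    "ternary_coeff n 3 = 3 * (3 * k + 1) * (3 * k + 2) / ((2 * k + 2) * (2 * k + 3)) * a"
    "ternary_coeff n 4 = 4 * (3 * k + 1) * (3 * k + 2) * (3 * k + 3) / ((2 * k + 2) * (2 * k + 3) * (2 * k + 4)) * a"
proof -
  have coeff: "ternary_coeff n (of_nat r) = of_nat r * x / y * a"
    if "r \<ge> 1" "fact (3 * n + r - 1) = x * fact (3 * n)" "fact (2 * n + r) = y * fact (2 * n + 1)" for r x y
    unfolding ternary_coeff_fact[OF that(1)] that(2,3) a_def times_divide_times_eq by (simp only: mult_ac)
  show "ternary_coeff n 1 = a" using coeff[of 1 1 1] by simp
  show "ternary_coeff n 2 = 2 * (3 * k + 1) / (2 * k + 2) * a"
    using coeff[of 2 "3 * k + 1" "2 * k + 2"] by (simp add: k_def)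
  show "ternary_coeff n 3 = 3 * (3 * k + 1) * (3 * k + 2) / ((2 * k + 2) * (2 * k + 3)) * a"
  proof -
    have "fact (3 * n + 3 - 1) = ((3 * k + 1) * (3 * k + 2)) * fact (3 * n)"
      "fact (2 * n + 3) = ((2 * k + 2) * (2 * k + 3)) * (fact (2 * n + 1) :: rat)"
      by (simp_all add: k_def eval_nat_numeral algebra_simps)
    then show ?thesis using coeff[of 3] by (simp add: mult.assoc)
  qed
  show "ternary_coeff n 4 = 4 * (3 * k + 1) * (3 * k + 2) * (3 * k + 3) / ((2 * k + 2) * (2 * k + 3) * (2 * k + 4)) * a"
  proof -
    have "fact (3 * n + 4 - 1) = ((3 * k + 1) * (3 * k + 2) * (3 * k + 3)) * fact (3 * n)"
      "fact (2 * n + 4) = ((2 * k + 2) * (2 * k + 3) * (2 * k + 4)) * (fact (2 * n + 1) :: rat)"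
      by (simp_all add: k_def eval_nat_numeral algebra_simps)
    then show ?thesis using coeff[of 4] by (simp add: mult.assoc)
  qed
qed

lemma K_term_eq: "K_term n = 4 ^ n * (fact (3 * n) / (fact (n + 1) * fact (2 * n + 1)))"
  by (simp only: K_term_def times_divide_eq_right)

text \<open>Kreweras' formula.\<close>
theorem word_count_closed: "word_count n n n = K_term n"
proof -
  obtain K F where KF: "boundary_eq 1 K F" "8 * F $ 0 = tp.w * (4 - tp.W^3)"
    using tp.kreweras_solution by blast
  have p: "tpow 1 ^ 2 = tpow 2" unfolding tpow_power by simp
  have "4 * (2 * F $ 0) = 4 * (3 * tpow 1 - tpow 2)"
    using KF(2) unfolding w_tpow W3_tpow p[symmetric] by algebra
  then have "2 * F $ 0 = 3 * tpow 1 - tpow 2" by (simp only: mult_cancel_left) simp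
  then have "(2 * F $ 0) $ (3 * n) = (3 * tpow 1 - tpow 2) $ (3 * n)" by simp
  then have "2 * F $ 0 $ (3 * n) = 4 ^ n * (3 * ternary_coeff n 1 - ternary_coeff n 2)"
    unfolding numeral_fps_const fps_mult_left_const_nth fps_sub_nth tpow_nth by (simp add: algebra_simps)
  also have "3 * ternary_coeff n 1 - ternary_coeff n 2 = 2 * (fact (3 * n) / (fact (n + 1) * fact (2 * n + 1)))"
  proof -
    define a :: rat where "a = fact (3 * n) / (fact n * fact (2 * n + 1))"
    have "fact (3 * n) / (fact (n + 1) * fact (2 * n + 1)) = a / (of_nat n + 1)"
      by (simp add: a_def)
    moreover have "of_nat n + 1 \<noteq> (0 :: rat)" "2 * of_nat n + 2 = 2 * (of_nat n + 1 :: rat)"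
      by (simp_all add: add_eq_0_iff)
    ultimately show ?thesis
      unfolding ternary_coeff_values a_def[symmetric] by (simp add: divide_simps) (simp add: algebra_simps)
  qed
  finally have "2 * F $ 0 $ (3 * n) = 2 * K_term n"
    unfolding K_term_eq by (simp only: mult.left_commute)
  then show ?thesis unfolding word_count_eq[OF KF(1)] by simp
qed

theorem early_count_closed:
  "early_count n n n = (1 - c_coeff n) * (3 * of_nat n + 1) * K_term n - T_term n"
proof -
  define d :: "rat fps fps" where "d = quadratic_series 1 (fps_X^2)"
  have d: "d = 1 + fps_const (fps_X^2) * (fps_X * d^2)"
    using quadratic_series[of 1 "fps_X^2 :: rat fps"] unfolding d_def[symmetric] by simp
  have dy: "lift_y d = 1 + tt^2*yy*lift_y d^2"
    using arg_cong[OF d, of lift_y] unfolding lift_y_hom lift_x_hom lift_t_hom by (simp only: mult.assoc)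
  have "1 - tt*xx*yy dvd 1" "1 - tt*xx*yy - tt^2*yy*lift_y d dvd 1"
    by (rule ser3_unitI; simp add: ser3_nth_0 fps_power_zeroth)+
  then obtain I1 I2 where I: "I1 * (1 - tt*xx*yy) = 1" "I2 * (1 - tt*xx*yy - tt^2*yy*lift_y d) = 1"
    by (metis dvdE mult.commute)
  have I2': "swap I2 * (1 - tt*xx*yy - tt^2*xx*lift_x d) = 1"
    using arg_cong[OF I(2), of swap] by (simp add: swap_simps mult_ac)
  obtain K F where KF: "boundary_eq I1 K F" "4 * tpow (1/2)^3 * fps_X^3 * F $ 0 = 4 * tpow (1/2)^3 - (2*tpow (1/2)^4 + tpow (1/2)^2 + 1)"
    using tp.diagonal_source_solution[OF I(1)] by blast
  obtain K' F' where KF': "boundary_eq (I2 + swap I2) K' F'"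
    "128 * F' $ 0 = tp.w^2 * (5 * (tp.W^3)^2 - 8 * tp.W^3 + 2 * (tp.W^3 - 4)^2) - 8 * tp.w^3 * (tp.W^3 - 2)"
    using tp.ballot_sources_solution[OF d I(2) I2'] by blast
  define k where "k = (of_nat n :: rat)"
  have k: "k \<ge> 0" by (simp add: k_def)
  have p: "tpow 1 ^ 2 = tpow 2" "tpow 1 ^ 3 = tpow 3" "tpow 1 ^ 4 = tpow 4" unfolding tpow_power by simp_all
  have "16 * (8 * F' $ 0) = 16 * (27 * tpow 2 - 10 * tpow 3 - tpow 4)"
    using KF'(2) unfolding w_tpow W3_tpow p[symmetric] by algebra
  then have "8 * F' $ 0 = 27 * tpow 2 - 10 * tpow 3 - tpow 4" by (simp only: mult_cancel_left) simp
  then have "(8 * F' $ 0) $ (3 * n) = (27 * tpow 2 - 10 * tpow 3 - tpow 4) $ (3 * n)" by simp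
  then have "8 * F' $ 0 $ (3 * n) = 4 ^ n * (27 * ternary_coeff n 2 - 10 * ternary_coeff n 3 - ternary_coeff n 4)"
    unfolding numeral_fps_const fps_mult_left_const_nth fps_sub_nth tpow_nth by (simp add: algebra_simps)
  also have "27 * ternary_coeff n 2 - 10 * ternary_coeff n 3 - ternary_coeff n 4 = 
     8 * ((1 - c_coeff n) * (3 * k + 1) * (fact (3 * n) / (fact (n + 1) * fact (2 * n + 1))))"
  proof -
    define a :: rat where "a = fact (3 * n) / (fact n * fact (2 * n + 1))"
    have a: "fact (3 * n) / (fact (n + 1) * fact (2 * n + 1)) = a / (k + 1)"
      using k by (simp add: a_def k_def)
    note c = ternary_coeff_values[of n, folded k_def, folded a_def]
    have "k + 1 \<noteq> 0" "2 * k + 2 = 2 * (k + 1)" "2 * k + 3 \<noteq> 0" "2 * k + 4 = 2 * (k + 2)" "k + 2 \<noteq> 0" "3 * k + 3 = 3 * (k + 1)"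
      using k by simp_all
    then show ?thesis
      unfolding a c c_coeff_def k_def[symmetric]
      by (simp only:) (simp add: divide_simps, simp add: algebra_simps power2_eq_square power3_eq_cube)
  qed
  finally have "8 * F' $ 0 $ (3 * n) = 8 * ((1 - c_coeff n) * (3 * k + 1) * K_term n)"
    unfolding K_term_eq by (simp only: mult_ac)
  then have double: "F' $ 0 $ (3 * n) = (1 - c_coeff n) * (3 * k + 1) * K_term n" by simp
  have q: "tpow (1/2)^3 = tpow (3/2)" "tpow (1/2)^4 = tpow 2" "tpow (1/2)^2 = tpow 1" unfolding tpow_power by simp_all
  have inv: "tpow (-3/2) * tpow (3/2) = 1" "tpow (-3/2) * tpow 2 = tpow (1/2)" "tpow (-3/2) * tpow 1 = tpow (-1/2)"
    unfolding tpow_add[symmetric] by simp_all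
  have "4 * (fps_X^3 * F $ 0) = 4 - (2 * tpow (1/2) + tpow (-1/2) + tpow (-3/2))"
    using KF(2) inv unfolding q by algebra
  then have "(4 * (fps_X^3 * F $ 0)) $ (3 * Suc n) = (4 - (2 * tpow (1/2) + tpow (-1/2) + tpow (-3/2))) $ (3 * Suc n)"
    by simp
  moreover have "(4 * (fps_X^3 * F $ 0)) $ (3 * Suc n) = 4 * F $ 0 $ (3 * n)"
    unfolding numeral_fps_const fps_mult_left_const_nth fps_X_power_mult_nth by simp
  moreover have "(4 - (2 * tpow (1/2) + tpow (-1/2) + tpow (-3/2))) $ (3 * Suc n) = 
     - (4 ^ Suc n * (2 * ternary_coeff (Suc n) (1/2) + ternary_coeff (Suc n) (-1/2) + ternary_coeff (Suc n) (-3/2)))"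
    unfolding numeral_fps_const fps_mult_left_const_nth fps_sub_nth fps_add_nth tpow_nth by (simp add: algebra_simps)
  ultimately have "F $ 0 $ (3 * n) = - (4 ^ n * (2 * ternary_coeff (Suc n) (1/2) + ternary_coeff (Suc n) (-1/2) + ternary_coeff (Suc n) (-3/2)))"
    by simp
  also have "\<dots> = 3 * (7 * k + 5) / ((k + 1) * (4 * k + 3) * (4 * k + 5)) * (4 ^ n * ((of_nat (3 * n) + 1/2) gchoose n))"
  proof -
    have "- (x * (- 3 * b / c * h)) = 3 * b / c * (x * h)" for x b c h :: rat
      by simp
    then show ?thesis unfolding ternary_coeff_half k_def[symmetric] .
  qed
  also have "\<dots> = T_term n"
  proof -
    have "k + 1 \<noteq> 0" "4 * k + 3 \<noteq> 0" "4 * k + 5 \<noteq> 0" using k by linarith+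
    then show ?thesis unfolding gbinomial_half_prod T_term_def k_def[symmetric] by simp
  qed
  finally have single: "F $ 0 $ (3 * n) = T_term n" .
  show ?thesis
    using early_count_eq[OF I dy boundary_eq_diff[OF KF'(1) KF(1)], of n] double single
    by (simp add: k_def)
qed

theorem g_num_closed:
  assumes "n \<ge> 1"
  shows "of_nat (g_num n) = c_coeff n * (3 * of_nat n + 1) * K_term n + T_term n"
proof -
  have "of_nat (g_num n) = late_count n n n"
    using assms by (simp add: late_count_def g_num_eq)
  also have "\<dots> = (3 * of_nat n + 1) * word_count n n n - early_count n n n"
    by (simp add: early_count_def)
  finally show ?thesis
    unfolding word_count_closed early_count_closed by (simp add: algebra_simps)
qed

section \<open>Hypergeometric terms, independence and the recurrence\<close>
lemma poly_eventually_eqI: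
  fixes p q :: "rat poly"
  assumes "eventually (\<lambda>n. poly p (of_nat n) = poly q (of_nat n)) sequentially"
  shows "p = q"
proof (rule ccontr)
  assume "p \<noteq> q"
  then have "eventually (\<lambda>n. poly (p - q) (of_nat n) \<noteq> 0) sequentially"
    by (intro eventually_poly_nonzero) simp
  with assms have "eventually (\<lambda>n::nat. False) sequentially"
    by eventually_elim simp
  then show False by simp
qed

lemma ratfun_eval_Fract:
  assumes "poly q (of_nat n) \<noteq> 0"
  shows "ratfun_eval (Fract p q) n = poly p (of_nat n) / poly q (of_nat n)"
proof -
  define a b where "a = fst (quot_of_fract (Fract p q))" and "b = snd (quot_of_fract (Fract p q))"
  have q: "q \<noteq> 0" using assms by auto
  have b: "b \<noteq> 0" by (simp add: b_def)
  have "coprime a b"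
    using quot_of_fract_in_normalized_fracts[of "Fract p q"] by (simp add: normalized_fracts_def a_def b_def case_prod_unfold)
  have "Fract a b = Fract p q"
    unfolding a_def b_def by (rule Fract_quot_of_fract)
  then have e: "a * q = p * b"
    using b q by (simp add: eq_fract)
  then have "b dvd a * q" by simp
  then have "b dvd q" using \<open>coprime a b\<close> by (simp add: coprime_dvd_mult_right_iff coprime_commute)
  then have "poly b (of_nat n) \<noteq> 0" using assms by (auto elim!: dvdE)
  moreover have "poly a (of_nat n) * poly q (of_nat n) = poly p (of_nat n) * poly b (of_nat n)"
    using e by (metis poly_mult)
  ultimately show ?thesis
    using assms by (simp add: ratfun_eval_def a_def b_def frac_eq_eq)
qed

lemma hypergeometric_termI:
  assumes "\<And>n. n \<ge> 1 \<Longrightarrow> f n \<noteq> 0" "\<And>n. n \<ge> 1 \<Longrightarrow> poly q (of_nat n) \<noteq> 0"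
    "\<And>n. n \<ge> 1 \<Longrightarrow> f (n + 1) * poly q (of_nat n) = f n * poly p (of_nat n)"
  shows "hypergeometric_term f"
  unfolding hypergeometric_term_def
proof (intro exI[of _ "Fract p q"] allI impI conjI)
  fix n :: nat assume n: "n \<ge> 1"
  then show "f n \<noteq> 0" by (rule assms)
  show "f (n + 1) / f n = ratfun_eval (Fract p q) n"
    unfolding ratfun_eval_Fract[OF assms(2)[OF n]] using assms[OF n] by (simp add: frac_eq_eq mult_ac)
qed

lemma linear_of_nat_nonzero:
  "a * of_nat n + numeral b \<noteq> (0 :: rat)" if "a \<ge> 0"
proof -
  have "a * of_nat n \<ge> 0" "(0 :: rat) < numeral b" using that by simp_all
  then show ?thesis by linarith
qed

lemma K_term_nonzero: "K_term n \<noteq> 0"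
  by (simp add: K_term_def)

lemma K_term_Suc:
  "K_term (Suc n) * ((of_nat n + 2) * (2 * of_nat n + 3)) = K_term n * (6 * (3 * of_nat n + 1) * (3 * of_nat n + 2))"
proof -
  define k where "k = (of_nat n :: rat)"
  have k: "k \<ge> 0" by (simp add: k_def)
  define F where "F = (fact (3 * n) :: rat)"
  define G where "G = (fact (n + 1) :: rat)"
  define H where "H = (fact (2 * n + 1) :: rat)"
  have "fact (3 * Suc n) = (3 * k + 3) * (3 * k + 2) * (3 * k + 1) * F" 
    by (simp add: F_def k_def eval_nat_numeral algebra_simps)
  moreover have "fact (Suc n + 1) = (k + 2) * G" by (simp add: G_def k_def)
  moreover have "fact (2 * Suc n + 1) = (2 * k + 3) * (2 * k + 2) * H" by (simp add: H_def k_def eval_nat_numeral algebra_simps)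
  ultimately have "K_term (Suc n) = 4 * 4 ^ n * ((3 * k + 3) * (3 * k + 2) * (3 * k + 1) * F) / ((k + 2) * G * ((2 * k + 3) * (2 * k + 2) * H))"
    unfolding K_term_def by (simp only: power_Suc)
  also have "\<dots> = K_term n * (4 * ((3 * k + 3) * (3 * k + 2) * (3 * k + 1)) / ((k + 2) * ((2 * k + 3) * (2 * k + 2))))"
    unfolding K_term_def F_def[symmetric] G_def[symmetric] H_def[symmetric] times_divide_times_eq by (simp only: mult_ac)
  finally have e: "K_term (Suc n) = \<dots>" .
  have "k + 2 \<noteq> 0" "2 * k + 3 \<noteq> 0" "2 * k + 2 \<noteq> 0"
    using k by linarith+
  then have "4 * ((3 * k + 3) * (3 * k + 2) * (3 * k + 1)) / ((k + 2) * ((2 * k + 3) * (2 * k + 2))) * ((k + 2) * (2 * k + 3))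
    = 6 * (3 * k + 1) * (3 * k + 2)"
    by (simp add: divide_simps) (simp add: algebra_simps)
  then show ?thesis unfolding e k_def[symmetric] by (simp only: mult.assoc)
qed

text \<open>The product in \<open>T(n)\<close>, whose ratio does not involve the factor \<open>7n + 5\<close>.\<close>
definition T_prod :: "nat \<Rightarrow> rat" where
  "T_prod n = (\<Prod>k = 1..n. 6 * (2 * of_nat k - 1) * (6 * of_nat k - 1) * (6 * of_nat k + 1) /
        ((of_nat k + 1) * (4 * of_nat k + 3) * (4 * of_nat k + 5)))"

lemma T_term_eq: "T_term n = (7 * of_nat n + 5) / 5 * T_prod n"
  by (simp add: T_term_def T_prod_def)

lemma T_prod_Suc:
  "T_prod (Suc n) * ((of_nat n + 2) * (4 * of_nat n + 7) * (4 * of_nat n + 9)) =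
   T_prod n * (6 * (2 * of_nat n + 1) * (6 * of_nat n + 5) * (6 * of_nat n + 7))"
proof -
  define k where "k = (of_nat n :: rat)"
  have "k \<ge> 0" by (simp add: k_def)
  then have k: "k + 2 \<noteq> 0" "4 * k + 7 \<noteq> 0" "4 * k + 9 \<noteq> 0" by linarith+
  have e: "T_prod (Suc n) = T_prod n * (6 * (2 * (k + 1) - 1) * (6 * (k + 1) - 1) * (6 * (k + 1) + 1) /
        (((k + 1) + 1) * (4 * (k + 1) + 3) * (4 * (k + 1) + 5)))"
    by (simp add: T_prod_def k_def add.commute)
  have s: "(k + 1) + 1 = k + 2" "4 * (k + 1) + 3 = 4 * k + 7" "4 * (k + 1) + 5 = 4 * k + 9"
     "2 * (k + 1) - 1 = 2 * k + 1" "6 * (k + 1) - 1 = 6 * k + 5" "6 * (k + 1) + 1 = 6 * k + 7" by simp_all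
  show ?thesis using k unfolding k_def[symmetric] e s by simp
qed

lemma T_prod_nonzero: "T_prod n \<noteq> 0"
proof -
  have "2 * of_nat k - 1 \<noteq> (0::rat)" "6 * of_nat k - 1 \<noteq> (0::rat)" "6 * of_nat k + 1 \<noteq> (0::rat)"
    "of_nat k + 1 \<noteq> (0::rat)" "4 * of_nat k + 3 \<noteq> (0::rat)" "4 * of_nat k + 5 \<noteq> (0::rat)"
    if "k \<ge> 1" for k :: nat
  proof -
    have "(of_nat k :: rat) \<ge> 1" using that by simp
    then show "2 * of_nat k - 1 \<noteq> (0::rat)" "6 * of_nat k - 1 \<noteq> (0::rat)" "6 * of_nat k + 1 \<noteq> (0::rat)"
      "of_nat k + 1 \<noteq> (0::rat)" "4 * of_nat k + 3 \<noteq> (0::rat)" "4 * of_nat k + 5 \<noteq> (0::rat)" by linarith+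
  qed
  then show ?thesis unfolding T_prod_def by (simp add: prod_zero_iff)
qed

lemma T_term_nonzero: "T_term n \<noteq> 0"
  using linear_of_nat_nonzero[of 7 n] T_prod_nonzero[of n] by (simp add: T_term_eq)

lemma T_term_Suc:
  "T_term (Suc n) * ((7 * of_nat n + 5) * (of_nat n + 2) * (4 * of_nat n + 7) * (4 * of_nat n + 9)) =
   T_term n * (6 * (7 * of_nat n + 12) * (2 * of_nat n + 1) * (6 * of_nat n + 5) * (6 * of_nat n + 7))"
proof -
  define k where "k = (of_nat n :: rat)"
  have "T_term (Suc n) = (7 * k + 12) / 5 * T_prod (Suc n)" "T_term n = (7 * k + 5) / 5 * T_prod n"
    by (simp_all add: T_term_eq k_def)
  moreover note T_prod_Suc[of n, folded k_def]
  ultimately show ?thesis unfolding k_def[symmetric] by algebra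
qed

abbreviation (input) K_lin :: "nat \<Rightarrow> rat" where "K_lin \<equiv> \<lambda>n. (3 * of_nat n + 1) * K_term n"

lemma K_lin_nonzero: "K_lin n \<noteq> 0"
  using linear_of_nat_nonzero[of 3 n Num.One] K_term_nonzero[of n] by simp

lemma K_lin_Suc:
  "K_lin (Suc n) * ((of_nat n + 2) * (2 * of_nat n + 3)) = K_lin n * (6 * (3 * of_nat n + 4) * (3 * of_nat n + 2))"
proof -
  have "(3 * of_nat (Suc n) + 1 :: rat) = 3 * of_nat n + 4" by simp
  then show ?thesis using K_term_Suc[of n] by algebra
qed

lemma hypergeometric_K_lin: "hypergeometric_term K_lin"
proof (rule hypergeometric_termI)
  show "poly ([:2, 1:] * [:3, 2:]) (of_nat n) \<noteq> (0 :: rat)" for n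
    using linear_of_nat_nonzero[of 1 n] linear_of_nat_nonzero[of 2 n] unfolding poly_mult by (simp add: ac_simps)
  show "K_lin (n + 1) * poly ([:2, 1:] * [:3, 2:]) (of_nat n) = K_lin n * poly ([:6:] * [:4, 3:] * [:2, 3:]) (of_nat n)" for n
    using K_lin_Suc[of n] unfolding poly_mult by (simp add: algebra_simps)
qed (rule K_lin_nonzero)

lemma hypergeometric_T_term: "hypergeometric_term T_term"
proof (rule hypergeometric_termI)
  show "poly ([:5, 7:] * [:2, 1:] * [:7, 4:] * [:9, 4:]) (of_nat n) \<noteq> (0 :: rat)" for n
    using linear_of_nat_nonzero[of 7 n] linear_of_nat_nonzero[of 1 n] linear_of_nat_nonzero[of 4 n] unfolding poly_mult by (simp add: ac_simps)
  show "T_term (n + 1) * poly ([:5, 7:] * [:2, 1:] * [:7, 4:] * [:9, 4:]) (of_nat n)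
    = T_term n * poly ([:6:] * [:12, 7:] * [:1, 2:] * [:5, 6:] * [:7, 6:]) (of_nat n)" for n
    using T_term_Suc[of n] unfolding poly_mult by (simp add: mult_ac add_ac)
qed (rule T_term_nonzero)

lemma order_pcompose_shift:
  assumes nz: "p \<noteq> 0"
  shows "order a (pcompose p [:b, 1:]) = order (a + b) (p :: rat poly)"
proof -
  have pc0: "pcompose p [:b, 1:] \<noteq> 0" using nz by (simp add: pcompose_eq_0_iff)
  have pow: "pcompose (f ^ n) g = pcompose f g ^ n" for f g :: "rat poly" and n
    by (induction n) (simp_all add: pcompose_mult pcompose_1)
  obtain q where q: "p = [:- (a + b), 1:] ^ order (a + b) p * q" "\<not> [:- (a + b), 1:] dvd q"
    using order_decomp[OF nz] by blast
  have "pcompose p [:b, 1:] = [:- a, 1:] ^ order (a + b) p * pcompose q [:b, 1:]"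
    by (subst q(1)) (simp add: pcompose_mult pow pcompose_pCons)
  moreover have "poly (pcompose q [:b, 1:]) a \<noteq> 0"
    using q(2) by (simp add: poly_pcompose poly_eq_0_iff_dvd add.commute)
  ultimately show ?thesis
    by (metis order_0I order_mult order_power_n_n add.right_neutral pc0)
qed

lemma finite_orders: "finite {c. order c (p :: rat poly) \<noteq> 0}" if "p \<noteq> 0"
proof (rule finite_subset)
  show "{c. order c p \<noteq> 0} \<subseteq> {c. poly p c = 0}" by (auto simp: order_root)
  show "finite {c. poly p c = 0}" using that by (rule poly_roots_finite)
qed

text \<open>
  The equation says that \<open>R = \<alpha>/\<beta>\<close> has the ratio \<open>R(n+1)/R(n)\<close> of the quotient of the two terms. Let \<open>f j\<close> be its order at
  \<open>-7/4 + j\<close>. Among the linear factors only \<open>4n + 7\<close> has a root in this class, so \<open>f\<close> is constant on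
  \<open>j \<ge> 1\<close> and on \<open>j \<le> 0\<close>, and the two constants differ by \<open>1\<close>. But \<open>f\<close> is \<open>0\<close> for all but finitely many \<open>j\<close>.
\<close>
lemma no_rational_quotient:
  fixes \<alpha> \<beta> :: "rat poly"
  assumes "\<alpha> \<noteq> 0" "\<beta> \<noteq> 0"
    and eq: "pcompose \<alpha> [:1, 1:] * \<beta> * ([:3, 2:] * [:12, 7:] * [:1, 2:] * [:5, 6:] * [:7, 6:])
       = \<alpha> * pcompose \<beta> [:1, 1:] * ([:4, 3:] * [:2, 3:] * [:5, 7:] * [:7, 4:] * [:9, 4:])"
  shows False
proof -
  define f where "f j = int (order (-7/4 + of_int j) \<alpha>) - int (order (-7/4 + of_int j) \<beta>)" for j :: int
  have step: "f (j + 1) = f j + (if j = 0 then 1 else 0)" for j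
  proof -
    define c :: rat where "c = -7/4 + of_int j"
    have ne: "a * of_int j \<noteq> (of_int b :: rat)" if "\<And>j::int. a' * j \<noteq> b" "a = of_int a'" for a b a'
      unfolding that(2) of_int_mult[symmetric] of_int_eq_iff by (rule that(1))
    have dvd: "a * j \<noteq> b" if "\<not> a dvd b" for a b j :: int using that by auto
    have "poly ([:3, 2:] * [:12, 7:] * [:1, 2:] * [:5, 6:] * [:7, 6:]) c \<noteq> 0"
      unfolding poly_mult c_def mult_eq_0_iff de_Morgan_disj
      using ne[OF dvd, of 4 1 4] ne[OF dvd, of 28 1 28] ne[OF dvd, of 4 5 4] ne[OF dvd, of 12 11 12] ne[OF dvd, of 12 7 12]
      by (intro conjI; simp add: field_simps)
    then have Lnz: "[:3, 2:] * [:12, 7:] * [:1, 2:] * [:5, 6:] * [:7, 6:] \<noteq> (0 :: rat poly)"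
      and L: "order c ([:3, 2:] * [:12, 7:] * [:1, 2:] * [:5, 6:] * [:7, 6:]) = 0" by (metis poly_0, rule order_0I)
    have "poly ([:4, 3:] * [:2, 3:] * [:5, 7:] * [:9, 4:]) c \<noteq> 0"
      unfolding poly_mult c_def mult_eq_0_iff de_Morgan_disj
      using ne[OF dvd, of 12 5 12] ne[OF dvd, of 12 13 12] ne[OF dvd, of 28 29 28] ne[OF dvd, of 2 "-1" 2]
      by (intro conjI; simp add: field_simps)
    then have R1nz: "[:4, 3:] * [:2, 3:] * [:5, 7:] * [:9, 4:] \<noteq> (0 :: rat poly)"
      and R1: "order c ([:4, 3:] * [:2, 3:] * [:5, 7:] * [:9, 4:]) = 0" by (metis poly_0, rule order_0I)
    have R2: "order c [:7, 4:] = (if j = 0 then 1 else 0)"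
    proof (cases "j = 0")
      case True
      have "[:7, 4:] = smult 4 ([:- c, 1:] ^ 1)" by (simp add: c_def True)
      then show ?thesis using True by (simp only: order_smult order_power_n_n) simp
    next
      case False
      then show ?thesis by (simp add: c_def order_0I)
    qed
    have om: "order c (p1 * p2 * p3) = order c p1 + order c p2 + order c p3"
      if "p1 \<noteq> 0" "p2 \<noteq> 0" "p3 \<noteq> 0" for p1 p2 p3 :: "rat poly"
      using that by (simp add: order_mult)
    have pc: "pcompose \<alpha> [:1, 1:] \<noteq> 0" "pcompose \<beta> [:1, 1:] \<noteq> 0"
      using assms(1,2) by (simp_all add: pcompose_eq_0_iff)
    have R2nz: "[:7, 4:] \<noteq> (0 :: rat poly)" by simp
    have "order c (pcompose \<alpha> [:1, 1:] * \<beta> * ([:3, 2:] * [:12, 7:] * [:1, 2:] * [:5, 6:] * [:7, 6:])) = order (c + 1) \<alpha> + order c \<beta>"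
      unfolding om[OF pc(1) assms(2) Lnz] by (simp only: L order_pcompose_shift[OF assms(1)] add_0_right)
    moreover have "\<alpha> * pcompose \<beta> [:1, 1:] * ([:4, 3:] * [:2, 3:] * [:5, 7:] * [:7, 4:] * [:9, 4:]) = 
       \<alpha> * pcompose \<beta> [:1, 1:] * (([:4, 3:] * [:2, 3:] * [:5, 7:] * [:9, 4:]) * [:7, 4:])"
      by (simp only: mult_ac)
    moreover have "order c \<dots> = order c \<alpha> + order (c + 1) \<beta> + (if j = 0 then 1 else 0)"
      unfolding om[OF assms(1) pc(2) no_zero_divisors[OF R1nz R2nz]] order_mult[OF no_zero_divisors[OF R1nz R2nz]]
      by (simp only: R1 R2 order_pcompose_shift[OF assms(2)] add_0_left)
    ultimately have "order (c + 1) \<alpha> + order c \<beta> = order c \<alpha> + order (c + 1) \<beta> + (if j = 0 then 1 else 0)"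
      using eq by simp
    moreover have "c + 1 = -7/4 + of_int (j + 1)" by (simp add: c_def)
    ultimately show ?thesis unfolding f_def c_def by (simp split: if_splits)
  qed
  have up: "f (1 + int n) = f 1" for n
    using step[of "1 + int n" for n] by (induction n) (simp_all add: add.assoc)
  have down: "f (- int n) = f 0" for n
  proof (induction n)
    case (Suc n)
    then show ?case using step[of "- int (Suc n)"] by simp
  qed simp
  have zero: "\<exists>n. f (g n) = 0" if "inj g" for g :: "nat \<Rightarrow> int"
  proof (rule ccontr)
    assume *: "\<nexists>n. f (g n) = 0"
    have "range (\<lambda>n. -7/4 + of_int (g n)) \<subseteq> {c. order c \<alpha> \<noteq> 0} \<union> {c. order c \<beta> \<noteq> 0}"
    proof (rule image_subsetI)
      fix n
      have "f (g n) \<noteq> 0" using * by blast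
      then show "-7/4 + of_int (g n) \<in> {c. order c \<alpha> \<noteq> 0} \<union> {c. order c \<beta> \<noteq> 0}"
        unfolding f_def Un_iff mem_Collect_eq by linarith
    qed
    then have "finite (range (\<lambda>n. -7/4 + of_int (g n) :: rat))"
      by (rule finite_subset) (intro finite_UnI finite_orders assms(1,2))
    moreover have "inj (\<lambda>n. -7/4 + of_int (g n) :: rat)" using that by (simp add: inj_def)
    ultimately show False by (simp add: finite_image_iff)
  qed
  have "f 1 = 0" using zero[of "\<lambda>n. 1 + int n"] up by (auto simp: inj_def)
  moreover have "f 0 = 0" using zero[of "\<lambda>n. - int n"] down by (auto simp: inj_def)
  ultimately show False using step[of 0] by simp
qed

lemma K_lin_T_not_proportional:
  assumes "eventually (\<lambda>n. K_lin n = ratfun_eval r n * T_term n) sequentially"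
  shows False
proof -
  obtain \<alpha> \<beta> where r: "r = Fract \<alpha> \<beta>" "\<beta> \<noteq> 0" by (cases r) auto
  have ev: "eventually (\<lambda>n. K_lin n * poly \<beta> (of_nat n) = poly \<alpha> (of_nat n) * T_term n \<and> poly \<beta> (of_nat n) \<noteq> 0) sequentially"
    using assms eventually_ratfun_eval_Fract[OF r(2), of \<alpha>] eventually_poly_nonzero[OF r(2)]
    unfolding r(1) by eventually_elim simp
  have "\<alpha> \<noteq> 0"
  proof
    assume "\<alpha> = 0"
    from ev have "eventually (\<lambda>n::nat. False) sequentially"
      by eventually_elim (use K_lin_nonzero in \<open>simp add: \<open>\<alpha> = 0\<close>\<close>)
    then show False by simp
  qed
  moreover note \<open>\<beta> \<noteq> 0\<close>
  moreover have "pcompose \<alpha> [:1, 1:] * \<beta> * ([:3, 2:] * [:12, 7:] * [:1, 2:] * [:5, 6:] * [:7, 6:])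
       = \<alpha> * pcompose \<beta> [:1, 1:] * ([:4, 3:] * [:2, 3:] * [:5, 7:] * [:7, 4:] * [:9, 4:])"
  proof (rule poly_eventually_eqI)
    have ev': "eventually (\<lambda>n. K_lin (Suc n) * poly \<beta> (of_nat (Suc n)) = poly \<alpha> (of_nat (Suc n)) * T_term (Suc n)
        \<and> poly \<beta> (of_nat (Suc n)) \<noteq> 0) sequentially"
      using ev by (rule eventually_sequentially_Suc[THEN iffD2])
    show "eventually (\<lambda>n. poly (pcompose \<alpha> [:1, 1:] * \<beta> * ([:3, 2:] * [:12, 7:] * [:1, 2:] * [:5, 6:] * [:7, 6:])) (of_nat n)
       = poly (\<alpha> * pcompose \<beta> [:1, 1:] * ([:4, 3:] * [:2, 3:] * [:5, 7:] * [:7, 4:] * [:9, 4:])) (of_nat n)) sequentially"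
      using ev ev'
    proof eventually_elim
      case (elim n)
      define k :: rat where "k = of_nat n"
      define a b a' b' where ab: "a = poly \<alpha> k" "b = poly \<beta> k" "a' = poly \<alpha> (1 + k)" "b' = poly \<beta> (1 + k)"
      have 1: "K_lin n * b = a * T_term n" "K_lin (Suc n) * b' = a' * T_term (Suc n)"
        using elim unfolding ab k_def by (simp_all add: add.commute)
      have K: "K_lin (Suc n) * ((k + 2) * (2 * k + 3)) = K_lin n * (6 * (3 * k + 4) * (3 * k + 2))"
        using K_lin_Suc[of n] unfolding k_def .
      have T: "T_term (Suc n) * ((7 * k + 5) * (k + 2) * (4 * k + 7) * (4 * k + 9)) = T_term n * (6 * (7 * k + 12) * (2 * k + 1) * (6 * k + 5) * (6 * k + 7))"
        using T_term_Suc[of n] unfolding k_def .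
      have nz: "6 * K_lin n * T_term n * (k + 2) \<noteq> 0"
        using K_lin_nonzero[of n] T_term_nonzero[of n] linear_of_nat_nonzero[of 1 n] unfolding k_def by simp
      have "(6 * K_lin n * T_term n * (k + 2)) * (a' * b * ((2*k+3)*(7*k+12)*(2*k+1)*(6*k+5)*(6*k+7)))
         = (6 * K_lin n * T_term n * (k + 2)) * (a * b' * ((3*k+4)*(3*k+2)*(7*k+5)*(4*k+7)*(4*k+9)))"
        using 1 K T by algebra
      with nz have "a' * b * ((2*k+3)*(7*k+12)*(2*k+1)*(6*k+5)*(6*k+7)) = a * b' * ((3*k+4)*(3*k+2)*(7*k+5)*(4*k+7)*(4*k+9))"
        by (simp only: mult_cancel_left simp_thms)
      then show ?case
        unfolding poly_mult poly_pcompose k_def[symmetric] by (simp add: ab mult_ac add_ac)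
    qed
  qed
  ultimately show False by (rule no_rational_quotient)
qed

lemma dim_germ_span: "germ.dim (germ.span {germ_of K_lin, germ_of T_term}) = 2"
proof -
  have notin: "germ_of K_lin \<notin> germ.span {germ_of T_term}"
  proof
    assume "germ_of K_lin \<in> germ.span {germ_of T_term}"
    then obtain r where "germ_of K_lin = germ_scale r (germ_of T_term)"
      by (auto simp: germ.span_singleton)
    then have "eventually (\<lambda>n. K_lin n = ratfun_eval r n * T_term n) sequentially"
      by transfer simp
    then show False by (rule K_lin_T_not_proportional)
  qed
  have "germ_of T_term \<noteq> 0"
  proof
    assume "germ_of T_term = 0"
    then have "eventually (\<lambda>n. T_term n = 0) sequentially" by transfer simp
    then show False by (simp add: T_term_nonzero)
  qed
  then have "germ.independent {germ_of K_lin, germ_of T_term}"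
    by (intro germ.independent_insertI[OF notin]) simp
  moreover have "germ_of K_lin \<noteq> germ_of T_term"
    using notin germ.span_base by fastforce
  ultimately show ?thesis by (simp add: germ.dim_eq_card_independent)
qed

lemma germ_in_span:
  assumes closed: "\<And>n. n \<ge> 1 \<Longrightarrow> g n = c_coeff n * (3 * of_nat n + 1) * K_term n + T_term n"
  shows "germ_of g \<in> germ.span {germ_of K_lin, germ_of T_term}"
proof -
  define q :: "rat poly" where "q = [:24, 28, 8:]"
  define r where "r = Fract [:-24, 1, 8:] q"
  have q: "q \<noteq> 0" by (simp add: q_def)
  have "germ_of g = germ_scale r (germ_of K_lin) + germ_of T_term"
  proof -
    have "eventually (\<lambda>n. g n = ratfun_eval r n * K_lin n + T_term n) sequentially"
      using eventually_ratfun_eval_Fract[OF q, of "[:-24, 1, 8:]"] eventually_ge_at_top[of 1]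
    proof eventually_elim
      case (elim n)
      have "c_coeff n = ratfun_eval r n"
        unfolding r_def elim c_coeff_def by (simp add: q_def algebra_simps power2_eq_square)
      then show ?case unfolding closed[OF elim(2)] by (simp add: mult.assoc)
    qed
    then show ?thesis by transfer
  qed
  then show ?thesis
    by (simp add: germ.span_add germ.span_scale germ.span_base)
qed

lemma closed_form_recurrence:
  assumes closed: "\<And>n. n \<ge> 1 \<Longrightarrow> g n = c_coeff n * (3 * of_nat n + 1) * K_term n + T_term n"
    and "m \<ge> 3"
  shows "poly p0_poly (of_nat m) * g m + poly p1_poly (of_nat m) * g (m - 1) + poly p2_poly (of_nat m) * g (m - 2) = 0"
proof -
  define n where "n = m - 2"
  have m: "m = Suc (Suc n)" "m - 1 = Suc n" "m - 2 = n" and n: "n \<ge> 1" using assms(2) by (simp_all add: n_def)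
  define x :: rat where "x = of_nat m"
  have x: "x \<ge> 3" using assms(2) by (simp add: x_def)
  have of_nat: "of_nat n = x - 2" "of_nat (Suc n) = x - 1" "of_nat (Suc (Suc n)) = x" by (simp_all add: x_def m)
  have nz: "x \<noteq> 0" "2 * x - 1 \<noteq> 0" "x + 1 \<noteq> 0" "2 * x + 1 \<noteq> 0" "x + 2 \<noteq> 0" "2 * x + 3 \<noteq> 0"
     "4 * x - 1 \<noteq> 0" "4 * x + 1 \<noteq> 0" "4 * x + 3 \<noteq> 0" "4 * x + 5 \<noteq> 0" using x by linarith+
  \<comment> \<open>Dividing by the product of all denominators that occur makes the three terms polynomial multiples of \<open>\<kappa>\<close>,
    and likewise of \<open>\<upsilon>\<close> below.\<close>
  define \<kappa> where "\<kappa> = K_term n / (4 * x * (2 * x - 1) * (x + 1) * (2 * x + 1) * (x + 2) * (2 * x + 3))"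
  have K0: "K_term n = \<kappa> * (4 * x * (2 * x - 1) * (x + 1) * (2 * x + 1) * (x + 2) * (2 * x + 3))"
    unfolding \<kappa>_def using nz by simp
  have "x * (2 * x - 1) * K_term (Suc n) = x * (2 * x - 1) * (\<kappa> * (24 * (3 * x - 5) * (3 * x - 4) * (x + 1) * (2 * x + 1) * (x + 2) * (2 * x + 3)))"
    using K_term_Suc[of n] unfolding of_nat K0 by algebra
  then have K1: "K_term (Suc n) = \<kappa> * (24 * (3 * x - 5) * (3 * x - 4) * (x + 1) * (2 * x + 1) * (x + 2) * (2 * x + 3))"
    using nz by (simp only: mult_cancel_left) simp
  have "(x + 1) * (2 * x + 1) * K_term (Suc (Suc n)) = (x + 1) * (2 * x + 1) * (\<kappa> * (144 * (3 * x - 5) * (3 * x - 4) * (3 * x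
      - 2) * (3 * x - 1) * (x + 2) * (2 * x + 3)))"
    using K_term_Suc[of "Suc n"] unfolding of_nat K1 by algebra
  then have K2: "K_term (Suc (Suc n)) = \<kappa> * (144 * (3 * x - 5) * (3 * x - 4) * (3 * x - 2) * (3 * x - 1) * (x + 2) * (2 * x + 3))"
    using nz by (simp only: mult_cancel_left) simp
  define \<upsilon> where "\<upsilon> = T_prod n / (5 * x * (4 * x - 1) * (4 * x + 1) * (x + 1) * (4 * x + 3) * (4 * x + 5))"
  have U0: "T_prod n = \<upsilon> * (5 * x * (4 * x - 1) * (4 * x + 1) * (x + 1) * (4 * x + 3) * (4 * x + 5))"
    unfolding \<upsilon>_def using nz by simp
  have "x * (4 * x - 1) * (4 * x + 1) * T_prod (Suc n) = x * (4 * x - 1) * (4 * x + 1) * (\<upsilon> * (30 * (2 * x - 3) * (6 * x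
      - 7) * (6 * x - 5) * (x + 1) * (4 * x + 3) * (4 * x + 5)))"
    using T_prod_Suc[of n] unfolding of_nat U0 by algebra
  then have U1: "T_prod (Suc n) = \<upsilon> * (30 * (2 * x - 3) * (6 * x - 7) * (6 * x - 5) * (x + 1) * (4 * x + 3) * (4 * x + 5))"
    using nz by (simp only: mult_cancel_left) simp
  have "(x + 1) * (4 * x + 3) * (4 * x + 5) * T_prod (Suc (Suc n)) = (x + 1) * (4 * x + 3) * (4 * x + 5) * (\<upsilon> * (180 * (2 * x
      - 3) * (6 * x - 7) * (6 * x - 5) * (2 * x - 1) * (6 * x - 1) * (6 * x + 1)))"
    using T_prod_Suc[of "Suc n"] unfolding of_nat U1 by algebra
  then have U2: "T_prod (Suc (Suc n)) = \<upsilon> * (180 * (2 * x - 3) * (6 * x - 7) * (6 * x - 5) * (2 * x - 1) * (6 * x - 1) * (6 * x + 1))"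
    using nz by (simp only: mult_cancel_left) simp
  have g: "20 * (y + 2) * (2 * y + 3) * g k = 5 * (8 * y^2 + y - 24) * (3 * y + 1) * K_term k
      + 4 * (y + 2) * (2 * y + 3) * (7 * y + 5) * T_prod k"
    if "k \<ge> 1" "of_nat k = y" for k y
  proof -
    have y: "y + 2 \<noteq> 0" "2 * y + 3 \<noteq> 0" using that(1) unfolding that(2)[symmetric] by linarith+
    have "4 * (y + 2) * (2 * y + 3) * c_coeff k = 8 * y^2 + y - 24"
      unfolding c_coeff_def that(2) using y by simp
    moreover have "5 * T_term k = (7 * y + 5) * T_prod k"
      unfolding T_term_eq that(2) by simp
    moreover have "g k = c_coeff k * (3 * y + 1) * K_term k + T_term k"
      unfolding closed[OF that(1)] that(2) ..
    ultimately show ?thesis by algebra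
  qed
  have g0: "g n = \<kappa> * ((8 * (x-2)^2 + (x-2) - 24) * (3 * x - 5) * (x + 1) * (2 * x + 1) * (x + 2) * (2 * x + 3)) 
      + \<upsilon> * ((7 * x - 9) * x * (4 * x - 1) * (4 * x + 1) * (x + 1) * (4 * x + 3) * (4 * x + 5))" (is "_ = ?r")
  proof -
    have "(20 * x * (2 * x - 1)) * g n = (20 * x * (2 * x - 1)) * ?r"
      using g[OF n of_nat(1)] unfolding K0 U0 by algebra
    then show ?thesis using nz by (simp only: mult_cancel_left mult_eq_0_iff) simp
  qed
  have g1: "g (Suc n) = \<kappa> * (6 * (8 * (x-1)^2 + (x-1) - 24) * (3 * x - 2) * (3 * x - 5) * (3 * x - 4) * (x + 2) * (2 * x + 3)) 
      + \<upsilon> * (6 * (7 * x - 2) * (2 * x - 3) * (6 * x - 7) * (6 * x - 5) * (x + 1) * (4 * x + 3) * (4 * x + 5))" (is "_ = ?r")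
  proof -
    have "(20 * (x + 1) * (2 * x + 1)) * g (Suc n) = (20 * (x + 1) * (2 * x + 1)) * ?r"
      using g[OF le_SucI[OF n] of_nat(2)] unfolding K1 U1 by algebra
    then show ?thesis using nz by (simp only: mult_cancel_left mult_eq_0_iff) simp
  qed
  have g2: "g (Suc (Suc n)) = \<kappa> * (36 * (8 * x^2 + x - 24) * (3 * x + 1) * (3 * x - 5) * (3 * x - 4) * (3 * x - 2) * (3 * x - 1)) 
      + \<upsilon> * (36 * (7 * x + 5) * (2 * x - 3) * (6 * x - 7) * (6 * x - 5) * (2 * x - 1) * (6 * x - 1) * (6 * x + 1))" (is "_ = ?r")
  proof -
    have "(20 * (x + 2) * (2 * x + 3)) * g (Suc (Suc n)) = (20 * (x + 2) * (2 * x + 3)) * ?r"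
      using g[OF le_SucI[OF le_SucI[OF n]] of_nat(3)] unfolding K2 U2 by algebra
    then show ?thesis using nz by (simp only: mult_cancel_left mult_eq_0_iff) simp
  qed
  show ?thesis
    unfolding x_def[symmetric] m(2,3) unfolding m(1) g0 g1 g2 p0_poly_def p1_poly_def p2_poly_def poly_pCons poly_0
    by algebra
qed

section \<open>The theorem\<close>

theorem theorem7p1:
  shows
    "(\<forall>n\<ge>1. of_nat (g_num n) = c_coeff n * (3 * of_nat n + 1) * K_term n + T_term n)
     \<and> hypergeometric_term (\<lambda>n. (3 * of_nat n + 1) * K_term n)
     \<and> hypergeometric_term T_term
     \<and> germ.dim (germ.span {germ_of (\<lambda>n. (3 * of_nat n + 1) * K_term n), germ_of T_term}) = 2
     \<and> germ_of (\<lambda>n. of_nat (g_num n))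
         \<in> germ.span {germ_of (\<lambda>n. (3 * of_nat n + 1) * K_term n), germ_of T_term}
     \<and> (\<exists>q0 q1 q2 :: rat poly. q0 \<noteq> 0 \<and> q2 \<noteq> 0 \<and>
          (\<forall>m\<ge>3. poly q0 (of_nat m) * of_nat (g_num m)
                + poly q1 (of_nat m) * of_nat (g_num (m - 1))
                + poly q2 (of_nat m) * of_nat (g_num (m - 2)) = 0))
     \<and> degree p0_poly = 12 \<and> degree p1_poly = 12 \<and> degree p2_poly = 12
     \<and> (\<forall>m\<ge>3. poly p0_poly (of_nat m) * of_nat (g_num m)
              + poly p1_poly (of_nat m) * of_nat (g_num (m - 1))
              + poly p2_poly (of_nat m) * of_nat (g_num (m - 2)) = 0)"
proof (intro conjI)
  note closed = g_num_closed
  show "\<forall>n\<ge>1. of_nat (g_num n) = c_coeff n * (3 * of_nat n + 1) * K_term n + T_term n"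
    using closed by blast
  show "hypergeometric_term (\<lambda>n. (3 * of_nat n + 1) * K_term n)"
    by (rule hypergeometric_K_lin)
  show "hypergeometric_term T_term"
    by (rule hypergeometric_T_term)
  show "germ.dim (germ.span {germ_of (\<lambda>n. (3 * of_nat n + 1) * K_term n), germ_of T_term}) = 2"
    by (rule dim_germ_span)
  show "germ_of (\<lambda>n. of_nat (g_num n))
         \<in> germ.span {germ_of (\<lambda>n. (3 * of_nat n + 1) * K_term n), germ_of T_term}"
    by (rule germ_in_span[OF closed])
  show rec: "\<forall>m\<ge>3. poly p0_poly (of_nat m) * of_nat (g_num m)
              + poly p1_poly (of_nat m) * of_nat (g_num (m - 1))
              + poly p2_poly (of_nat m) * of_nat (g_num (m - 2)) = 0"
    using closed_form_recurrence[OF closed] by blast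
  show "\<exists>q0 q1 q2 :: rat poly. q0 \<noteq> 0 \<and> q2 \<noteq> 0 \<and>
          (\<forall>m\<ge>3. poly q0 (of_nat m) * of_nat (g_num m)
                + poly q1 (of_nat m) * of_nat (g_num (m - 1))
                + poly q2 (of_nat m) * of_nat (g_num (m - 2)) = 0)"
    by (rule exI[of _ p0_poly], rule exI[of _ p1_poly], rule exI[of _ p2_poly])
      (use rec in \<open>simp add: p0_poly_def p2_poly_def\<close>)
  show "degree p0_poly = 12" "degree p1_poly = 12" "degree p2_poly = 12"
    by (simp_all add: p0_poly_def p1_poly_def p2_poly_def)
qed

end
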